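(* Assume that the set-valued map $K\setminus O\ni x\mapsto A(x)\subseteq A$ is compact-valued, upper hemicontinuous and weakly measurable, and that $Q$ is strongly Feller on $\mathbb K$, i.e. $\mathbb K\ni(x,a)\mapsto\int_X Q(\mathrm dy|x,a)g(y)$ is continuous and bounded for every bounded measurable $g:X\to\mathbb R$. For a given policy $\pi\in\Pi$ and an initial state $x\in X$ the following are equivalent: (i) $\pi$ is thrifty at $x$; (ii) $(\zeta_n)_{n\in\mathbb N_0}$ is an $(\mathfrak F_n)_{n\in\mathbb N_0}$-martingale under $\mathsf P^\pi_x$; (iii) for every $n\in\mathbb N_0$, $\mathsf P^\pi_x$-almost everywhere on $\{\tau\wedge\tau'>n\}$ the action $a_n$ conserves $V^\star$ at $x_n$.
   Context: A Borel space is a Borel subset of a Polish space, with Borel $\sigma$-algebra $\mathfrak B(\cdot)$; "measurable" means Borel measurable. $X$ (states) and $A$ (actions) are nonempty Borel spaces; for each $x\in X$, $A(x)$ is a nonempty measurable subset of $A$ (feasible actions); the set $\mathbb K_X=\{(x,a):x\in X,\ a\in A(x)\}$ is measurable in $X\times A$ and contains the graph of a measurable function $X\to A$; $Q$ is a stochastic kernel on $X$ given $\mathbb K_X$. $O\subsetneq K$ are nonempty measurable subsets of $X$. $\mathbb N_0=\{0,1,2,\dots\}$, $\mathbb N=\{1,2,\dots\}$, $a\wedge b=\min\{a,b\}$. Write $\mathbb K=\{(x,a):x\in K\setminus O,\ a\in A(x)\}$. A policy $\pi=(\pi_t)_{t\in\mathbb N_0}$ is a sequence of stochastic kernels $\pi_t$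 on $A$ given the histories $h_t=(x_0,a_0,\dots,x_{t-1},a_{t-1},x_t)$ with $\pi_t(A(x_t)|h_t)=1$; $\Pi$ is the set of all (randomized, history-dependent) policies. $\mathfrak F_t$ is the $\sigma$-algebra generated by $h_t$. Under $\mathsf P^\pi_x$ (expectation $\mathsf E^\pi_x$) one has $x_0=x$, $a_t$ has conditional law $\pi_t(\cdot|h_t)$ given $h_t$, and $x_{t+1}$ has conditional law $Q(\cdot|x_t,a_t)$ given $(h_t,a_t)$. Let $\tau=\inf\{t\in\mathbb N_0: x_t\in O\}$ and $\tau'=\inf\{t\in\mathbb N_0:x_t\in X\setminus K\}$ ($\inf\emptyset=\infty$), and $$V(\pi,x)=\mathsf P^\pi_x(\tau<\tau',\ \tau<\infty),\qquad V^\star(x)=\sup_{\pi\in\Pi}V(\pi,x).$$ The process is regarded as killed at $\tau\wedge\tau'$: policies prescribe $\pi_t$ only on $\{t<\tau\wedge\tau'\}$. Nothing below depends on actions taken at times $\ge\tau\wedge\tau'$; they may be taken to be given by an arbitrary fixed feasible measurable rule. For $x\in X$, $\pi\in\Pi$ and $n\in\mathbb N$ put $W_n(\pi,x)=\sum_{t=0}^{(n-1)\wedge\tau\wedge\tau'}\mathbf 1_O(x_t)$, and define $$\zeta_0=V^\star(x),\qquad \zeta_n=W_n(\pi,x)+\mathbf 1_{K\setminus O}(x_{(n-1)\wedge\tau\wedge\tau'})\,(\mathbf 1_K V^\star)(x_{n\wedge\tau\wedge\tau'}),\quad n\in\mathbb N .$$ Let $\Lambda^\pi(x)=\lim_{n\to\infty}\mathsf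 E^\pi_x[\zeta_n]$ (the sequence $\mathsf E^\pi_x[\zeta_n]$ is nonincreasing and nonnegative). A policy $\pi$ is thrifty at $x$ if $V^\star(x)=\Lambda^\pi(x)$. The action $a_n$, defined on $\{\tau\wedge\tau'>n\}$, conserves $V^\star$ at $x_n$ if $$\mathbf 1_O(x_n)+\mathbf 1_{K\setminus O}(x_n)\int_K Q(\mathrm dy|x_n,a_n)\,V^\star(y)=V^\star(x_n).$$ A set-valued map $\Psi$ is upper hemicontinuous if for every $x$ and every open neighbourhood $U$ of $\Psi(x)$ there is a neighbourhood $W$ of $x$ with $\Psi(z)\subseteq U$ for $z\in W$; it is weakly measurable if $\{x:\Psi(x)\cap G\ne\emptyset\}$ is measurable for every open $G$. *)

theory Defs
  imports "HOL-Probability.Probability"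
begin

section \<open>Set-valued maps\<close>

text \<open>Both notions are relative to the domain \<open>S\<close> and the codomain \<open>E\<close>, with subspace topologies.\<close>

definition upper_hemicontinuous_on ::
    "'x::topological_space set \<Rightarrow> 'a::topological_space set \<Rightarrow> ('x \<Rightarrow> 'a set) \<Rightarrow> bool" where
  "upper_hemicontinuous_on S E \<Psi> \<longleftrightarrow>
    (\<forall>x\<in>S. \<forall>U. openin (top_of_set E) U \<and> \<Psi> x \<subseteq> U \<longrightarrow>
      (\<exists>W. openin (top_of_set S) W \<and> x \<in> W \<and> (\<forall>z\<in>W. \<Psi> z \<subseteq> U)))"

definition weakly_measurable_on ::
    "'x::topological_space set \<Rightarrow> 'a::topological_space set \<Rightarrow> ('x \<Rightarrow> 'a set) \<Rightarrow> bool" where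
  "weakly_measurable_on S E \<Psi> \<longleftrightarrow>
    (\<forall>G. openin (top_of_set E) G \<longrightarrow>
      {x \<in> S. \<Psi> x \<inter> G \<noteq> {}} \<in> sets (restrict_space borel S))"

section \<open>Discrete-time martingales\<close>

definition martingale_wrt ::
    "'w measure \<Rightarrow> (nat \<Rightarrow> 'w measure) \<Rightarrow> (nat \<Rightarrow> 'w \<Rightarrow> real) \<Rightarrow> bool" where
  "martingale_wrt P F Z \<longleftrightarrow>
    filtration (space P) F \<and>
    (\<forall>n. subalgebra P (F n)) \<and>
    (\<forall>n. Z n \<in> borel_measurable (F n)) \<and>
    (\<forall>n. integrable P (Z n)) \<and>
    (\<forall>m n. m \<le> n \<longrightarrow> (AE \<omega> in P. real_cond_exp P (F m) (Z n) \<omega> = Z m \<omega>))"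

section \<open>The decision model\<close>

text \<open>The state and action spaces are Borel subsets of Polish spaces given as types.
  The field \<open>after_kill\<close> is the fixed feasible measurable rule that generates the
  (irrelevant) actions once the process has been killed.\<close>

record ('x, 'a) reach_mdp =
  states :: "'x set"
  actions :: "'a set"
  feas :: "'x \<Rightarrow> 'a set"
  trans :: "'x \<times> 'a \<Rightarrow> 'x measure"
  target :: "'x set"
  region :: "'x set"
  after_kill :: "'x \<Rightarrow> 'a"

type_synonym ('x, 'a) history = "(nat \<Rightarrow> 'x \<times> 'a) \<times> 'x"
type_synonym ('x, 'a) policy = "nat \<Rightarrow> ('x, 'a) history \<Rightarrow> 'a measure"

definition SX :: "('x::polish_space, 'a::polish_space) reach_mdp \<Rightarrow> 'x measure" where
  "SX M = restrict_space borel (states M)"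

definition SA :: "('x::polish_space, 'a::polish_space) reach_mdp \<Rightarrow> 'a measure" where
  "SA M = restrict_space borel (actions M)"

definition feasible_pairs :: "('x::polish_space, 'a::polish_space) reach_mdp \<Rightarrow> ('x \<times> 'a) set" where
  "feasible_pairs M = {(x, a). x \<in> states M \<and> a \<in> feas M x}"

definition live_states :: "('x::polish_space, 'a::polish_space) reach_mdp \<Rightarrow> 'x set" where
  "live_states M = region M - target M"

definition live_pairs :: "('x::polish_space, 'a::polish_space) reach_mdp \<Rightarrow> ('x \<times> 'a) set" where
  "live_pairs M = {(x, a). x \<in> live_states M \<and> a \<in> feas M x}"

definition is_reach_mdp :: "('x::polish_space, 'a::polish_space) reach_mdp \<Rightarrow> bool" where
  "is_reach_mdp M \<longleftrightarrow>
    states M \<in> sets borel \<and> states M \<noteq> {} \<and>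
    actions M \<in> sets borel \<and> actions M \<noteq> {} \<and>
    (\<forall>x\<in>states M. feas M x \<noteq> {} \<and> feas M x \<in> sets (SA M)) \<and>
    feasible_pairs M \<in> sets (SX M \<Otimes>\<^sub>M SA M) \<and>
    after_kill M \<in> SX M \<rightarrow>\<^sub>M SA M \<and> (\<forall>x\<in>states M. after_kill M x \<in> feas M x) \<and>
    trans M \<in> restrict_space (SX M \<Otimes>\<^sub>M SA M) (feasible_pairs M) \<rightarrow>\<^sub>M prob_algebra (SX M) \<and>
    target M \<in> sets (SX M) \<and> region M \<in> sets (SX M) \<and>
    target M \<noteq> {} \<and> target M \<subset> region M"

definition strongly_Feller :: "('x::polish_space, 'a::polish_space) reach_mdp \<Rightarrow> bool" where
  "strongly_Feller M \<longleftrightarrow>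
    (\<forall>g :: 'x \<Rightarrow> real. g \<in> borel_measurable (SX M) \<and> bounded (g ` states M) \<longrightarrow>
      continuous_on (live_pairs M) (\<lambda>p. \<integral>y. g y \<partial>trans M p) \<and>
      bounded ((\<lambda>p. \<integral>y. g y \<partial>trans M p) ` live_pairs M))"

section \<open>Policies\<close>

text \<open>A history \<open>(x\<^sub>0, a\<^sub>0, \<dots>, x\<^bsub>t-1\<^esub>, a\<^bsub>t-1\<^esub>, x\<^sub>t)\<close> is encoded as the pair of the function
  \<open>s \<mapsto> (x\<^sub>s, a\<^sub>s)\<close> on \<open>{0..<t}\<close> and the state \<open>x\<^sub>t\<close>.  A policy prescribes an action kernel
  only for those histories along which the process has not been killed up to time \<open>t\<close>.\<close>

definition hist_space ::
    "('x::polish_space, 'a::polish_space) reach_mdp \<Rightarrow> nat \<Rightarrow> ('x, 'a) history measure" where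
  "hist_space M t = PiM {0..<t} (\<lambda>_. SX M \<Otimes>\<^sub>M SA M) \<Otimes>\<^sub>M SX M"

definition live_hists ::
    "('x::polish_space, 'a::polish_space) reach_mdp \<Rightarrow> nat \<Rightarrow> ('x, 'a) history set" where
  "live_hists M t =
    {h \<in> space (hist_space M t). (\<forall>s<t. fst h s \<in> live_pairs M) \<and> snd h \<in> live_states M}"

definition policies :: "('x::polish_space, 'a::polish_space) reach_mdp \<Rightarrow> ('x, 'a) policy set" where
  "policies M =
    {\<pi>. \<forall>t. \<pi> t \<in> restrict_space (hist_space M t) (live_hists M t) \<rightarrow>\<^sub>M prob_algebra (SA M) \<and>
            (\<forall>h\<in>live_hists M t. measure (\<pi> t h) (feas M (snd h)) = 1)}"

section \<open>The law of the process\<close>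

definition act_kernel ::
    "('x::polish_space, 'a::polish_space) reach_mdp \<Rightarrow> ('x, 'a) policy \<Rightarrow> nat \<Rightarrow>
      ('x, 'a) history \<Rightarrow> 'a measure" where
  "act_kernel M \<pi> t h =
    (if h \<in> live_hists M t then \<pi> t h else return (SA M) (after_kill M (snd h)))"

text \<open>The extension of the transition law to infeasible pairs only serves to make the kernel
  total; such pairs are visited with probability zero.\<close>

definition trans_total ::
    "('x::polish_space, 'a::polish_space) reach_mdp \<Rightarrow> 'x \<times> 'a \<Rightarrow> 'x measure" where
  "trans_total M p = (if p \<in> feasible_pairs M then trans M p else return (SX M) (fst p))"

text \<open>The conditional law of \<open>(x\<^sub>t, a\<^sub>t)\<close> given \<open>\<omega> s = (x\<^sub>s, a\<^sub>s)\<close> for \<open>s < t\<close>.\<close>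

definition step_kernel ::
    "('x::polish_space, 'a::polish_space) reach_mdp \<Rightarrow> ('x, 'a) policy \<Rightarrow> 'x \<Rightarrow> nat \<Rightarrow>
      (nat \<Rightarrow> 'x \<times> 'a) \<Rightarrow> ('x \<times> 'a) measure" where
  "step_kernel M \<pi> x t \<omega> =
    (if t = 0 then return (SX M) x else trans_total M (\<omega> (t - 1))) \<bind>
      (\<lambda>y. act_kernel M \<pi> t (\<omega>, y) \<bind> (\<lambda>a. return (SX M \<Otimes>\<^sub>M SA M) (y, a)))"

definition mdp_law ::
    "('x::polish_space, 'a::polish_space) reach_mdp \<Rightarrow> ('x, 'a) policy \<Rightarrow> 'x \<Rightarrow>
      (nat \<Rightarrow> 'x \<times> 'a) measure" where
  "mdp_law M \<pi> x =
    projective_family.lim UNIV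
      (Ionescu_Tulcea.CI (step_kernel M \<pi> x) (\<lambda>_. SX M \<Otimes>\<^sub>M SA M))
      (\<lambda>_. SX M \<Otimes>\<^sub>M SA M)"

definition st :: "nat \<Rightarrow> (nat \<Rightarrow> 'x \<times> 'a) \<Rightarrow> 'x" where
  "st t \<omega> = fst (\<omega> t)"

definition ac :: "nat \<Rightarrow> (nat \<Rightarrow> 'x \<times> 'a) \<Rightarrow> 'a" where
  "ac t \<omega> = snd (\<omega> t)"

definition hist :: "nat \<Rightarrow> (nat \<Rightarrow> 'x \<times> 'a) \<Rightarrow> ('x, 'a) history" where
  "hist t \<omega> = (restrict \<omega> {0..<t}, st t \<omega>)"

definition hist_filtration ::
    "('x::polish_space, 'a::polish_space) reach_mdp \<Rightarrow> nat \<Rightarrow> (nat \<Rightarrow> 'x \<times> 'a) measure" where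
  "hist_filtration M t =
    vimage_algebra (space (PiM UNIV (\<lambda>_. SX M \<Otimes>\<^sub>M SA M))) (hist t) (hist_space M t)"

section \<open>Values, thrifty policies, conserving actions\<close>

definition tau :: "('x::polish_space, 'a::polish_space) reach_mdp \<Rightarrow> (nat \<Rightarrow> 'x \<times> 'a) \<Rightarrow> enat" where
  "tau M \<omega> = Inf {enat t | t. st t \<omega> \<in> target M}"

definition tau' :: "('x::polish_space, 'a::polish_space) reach_mdp \<Rightarrow> (nat \<Rightarrow> 'x \<times> 'a) \<Rightarrow> enat" where
  "tau' M \<omega> = Inf {enat t | t. st t \<omega> \<in> states M - region M}"

definition kill_time ::
    "('x::polish_space, 'a::polish_space) reach_mdp \<Rightarrow> (nat \<Rightarrow> 'x \<times> 'a) \<Rightarrow> enat" where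
  "kill_time M \<omega> = min (tau M \<omega>) (tau' M \<omega>)"

definition stopped ::
    "('x::polish_space, 'a::polish_space) reach_mdp \<Rightarrow> nat \<Rightarrow> (nat \<Rightarrow> 'x \<times> 'a) \<Rightarrow> nat" where
  "stopped M n \<omega> = the_enat (min (enat n) (kill_time M \<omega>))"

definition value_of ::
    "('x::polish_space, 'a::polish_space) reach_mdp \<Rightarrow> ('x, 'a) policy \<Rightarrow> 'x \<Rightarrow> real" where
  "value_of M \<pi> x =
    measure (mdp_law M \<pi> x)
      {\<omega> \<in> space (mdp_law M \<pi> x). tau M \<omega> < tau' M \<omega> \<and> tau M \<omega> < \<infinity>}"

definition Vstar :: "('x::polish_space, 'a::polish_space) reach_mdp \<Rightarrow> 'x \<Rightarrow> real" where
  "Vstar M x = (SUP \<pi>\<in>policies M. value_of M \<pi> x)"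

definition W :: "('x::polish_space, 'a::polish_space) reach_mdp \<Rightarrow> nat \<Rightarrow> (nat \<Rightarrow> 'x \<times> 'a) \<Rightarrow> real" where
  "W M n \<omega> = (\<Sum>t = 0..stopped M (n - 1) \<omega>. indicator (target M) (st t \<omega>))"

definition zeta ::
    "('x::polish_space, 'a::polish_space) reach_mdp \<Rightarrow> 'x \<Rightarrow> nat \<Rightarrow> (nat \<Rightarrow> 'x \<times> 'a) \<Rightarrow> real" where
  "zeta M x n \<omega> =
    (if n = 0 then Vstar M x
     else W M n \<omega> +
       indicator (live_states M) (st (stopped M (n - 1) \<omega>) \<omega>) *
       (indicator (region M) (st (stopped M n \<omega>) \<omega>) * Vstar M (st (stopped M n \<omega>) \<omega>)))"

definition Lambda ::
    "('x::polish_space, 'a::polish_space) reach_mdp \<Rightarrow> ('x, 'a) policy \<Rightarrow> 'x \<Rightarrow> real" where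
  "Lambda M \<pi> x = lim (\<lambda>n. \<integral>\<omega>. zeta M x n \<omega> \<partial>mdp_law M \<pi> x)"

definition thrifty_at ::
    "('x::polish_space, 'a::polish_space) reach_mdp \<Rightarrow> ('x, 'a) policy \<Rightarrow> 'x \<Rightarrow> bool" where
  "thrifty_at M \<pi> x \<longleftrightarrow> Vstar M x = Lambda M \<pi> x"

definition conserves_Vstar_at ::
    "('x::polish_space, 'a::polish_space) reach_mdp \<Rightarrow> 'a \<Rightarrow> 'x \<Rightarrow> bool" where
  "conserves_Vstar_at M a x \<longleftrightarrow>
    indicator (target M) x +
      indicator (live_states M) x * (LINT y:region M|trans M (x, a). Vstar M y) = Vstar M x"

section \<open>The law is well defined\<close>

lemma live_pairs_eq:
  assumes "is_reach_mdp M"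
  shows "live_pairs M = feasible_pairs M \<inter> (live_states M \<times> actions M)"
proof -
  have "region M \<subseteq> states M" "\<And>x. x \<in> states M \<Longrightarrow> feas M x \<subseteq> actions M"
    using assms sets.sets_into_space
    unfolding is_reach_mdp_def SX_def SA_def by (fastforce simp: space_restrict_space)+
  then show ?thesis
    unfolding live_pairs_def feasible_pairs_def live_states_def by blast
qed

lemma sets_live_pairs:
  assumes "is_reach_mdp M"
  shows "live_pairs M \<in> sets (SX M \<Otimes>\<^sub>M SA M)"
proof -
  have "actions M = space (SA M)"
    by (simp add: SA_def space_restrict_space)
  then show ?thesis
    using assms unfolding live_pairs_eq[OF assms] is_reach_mdp_def live_states_def by auto
qed

lemma sets_live_hists:
  assumes "is_reach_mdp M"
  shows "live_hists M t \<in> sets (hist_space M t)"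
proof -
  have [measurable]: "live_pairs M \<in> sets (SX M \<Otimes>\<^sub>M SA M)" "live_states M \<in> sets (SX M)"
    using assms sets_live_pairs unfolding is_reach_mdp_def live_states_def by auto
  have "live_hists M t =
      {h \<in> space (hist_space M t). (\<forall>s\<in>{0..<t}. fst h s \<in> live_pairs M) \<and> snd h \<in> live_states M}"
    by (auto simp: live_hists_def)
  also have "\<dots> \<in> sets (hist_space M t)"
    unfolding hist_space_def by measurable
  finally show ?thesis .
qed

lemma act_kernel_measurable:
  assumes "is_reach_mdp M" "\<pi> \<in> policies M"
  shows "act_kernel M \<pi> t \<in> hist_space M t \<rightarrow>\<^sub>M prob_algebra (SA M)"
proof -
  have [measurable]: "after_kill M \<in> SX M \<rightarrow>\<^sub>M SA M"
    using assms by (simp add: is_reach_mdp_def)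
  have "(\<lambda>h. return (SA M) (after_kill M (snd h))) \<in> hist_space M t \<rightarrow>\<^sub>M prob_algebra (SA M)"
    unfolding hist_space_def by measurable
  moreover have "\<pi> t \<in> restrict_space (hist_space M t) (live_hists M t) \<rightarrow>\<^sub>M prob_algebra (SA M)"
    using assms by (auto simp: policies_def)
  ultimately show ?thesis
    using sets_live_hists[OF assms(1), of t]
      sets.sets_into_space[OF sets_live_hists[OF assms(1), of t]]
    unfolding act_kernel_def[abs_def]
    by (subst measurable_If_restrict_space_iff)
       (auto simp: Int_absorb2 Int_def[symmetric] intro: measurable_restrict_space1)
qed

lemma trans_total_measurable:
  assumes "is_reach_mdp M"
  shows "trans_total M \<in> SX M \<Otimes>\<^sub>M SA M \<rightarrow>\<^sub>M prob_algebra (SX M)"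
proof -
  have F: "feasible_pairs M \<in> sets (SX M \<Otimes>\<^sub>M SA M)"
    and T: "trans M \<in> restrict_space (SX M \<Otimes>\<^sub>M SA M) (feasible_pairs M) \<rightarrow>\<^sub>M prob_algebra (SX M)"
    using assms by (auto simp: is_reach_mdp_def)
  have "(\<lambda>p. return (SX M) (fst p)) \<in> SX M \<Otimes>\<^sub>M SA M \<rightarrow>\<^sub>M prob_algebra (SX M)"
    by measurable
  then show ?thesis
    using F T sets.sets_into_space[OF F]
    unfolding trans_total_def[abs_def]
    by (subst measurable_If_restrict_space_iff)
       (auto simp: Int_absorb2 Int_def[symmetric] intro: measurable_restrict_space1)
qed

lemma step_kernel_measurable:
  assumes "is_reach_mdp M" "\<pi> \<in> policies M" "x \<in> states M"
  shows "step_kernel M \<pi> x t \<in> PiM {0..<t} (\<lambda>_. SX M \<Otimes>\<^sub>M SA M) \<rightarrow>\<^sub>M prob_algebra (SX M \<Otimes>\<^sub>M SA M)"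
proof -
  let ?N = "PiM {0..<t} (\<lambda>_. SX M \<Otimes>\<^sub>M SA M)"
  have x: "x \<in> space (SX M)"
    using assms by (simp add: SX_def space_restrict_space)
  have state: "(\<lambda>\<omega>. if t = 0 then return (SX M) x else trans_total M (\<omega> (t - 1)))
      \<in> ?N \<rightarrow>\<^sub>M prob_algebra (SX M)"
  proof (cases "t = 0")
    case True
    then show ?thesis
      using x by (simp add: space_prob_algebra prob_space_return)
  next
    case False
    then have "(\<lambda>\<omega>. \<omega> (t - 1)) \<in> ?N \<rightarrow>\<^sub>M SX M \<Otimes>\<^sub>M SA M"
      by (intro measurable_component_singleton) auto
    from measurable_compose[OF this trans_total_measurable[OF assms(1)]] False
    show ?thesis
      by simp
  qed
  have act: "act_kernel M \<pi> t \<in> ?N \<Otimes>\<^sub>M SX M \<rightarrow>\<^sub>M prob_algebra (SA M)"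
    using act_kernel_measurable[OF assms(1,2)] by (simp add: hist_space_def)
  have ret: "(\<lambda>(h, a). return (SX M \<Otimes>\<^sub>M SA M) (snd h, a))
      \<in> (?N \<Otimes>\<^sub>M SX M) \<Otimes>\<^sub>M SA M \<rightarrow>\<^sub>M prob_algebra (SX M \<Otimes>\<^sub>M SA M)"
    by measurable
  have "(\<lambda>h. act_kernel M \<pi> t h \<bind> (\<lambda>a. return (SX M \<Otimes>\<^sub>M SA M) (snd h, a)))
      \<in> ?N \<Otimes>\<^sub>M SX M \<rightarrow>\<^sub>M prob_algebra (SX M \<Otimes>\<^sub>M SA M)"
    by (rule measurable_bind_prob_space2[OF act]) (use ret in simp)
  then have "(\<lambda>(\<omega>, y). act_kernel M \<pi> t (\<omega>, y) \<bind> (\<lambda>a. return (SX M \<Otimes>\<^sub>M SA M) (y, a)))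
      \<in> ?N \<Otimes>\<^sub>M SX M \<rightarrow>\<^sub>M prob_algebra (SX M \<Otimes>\<^sub>M SA M)"
    by (simp add: split_beta')
  then show ?thesis
    unfolding step_kernel_def[abs_def] by (intro measurable_bind_prob_space2[OF state])
qed

lemma Ionescu_Tulcea_step_kernel:
  assumes "is_reach_mdp M" "\<pi> \<in> policies M" "x \<in> states M"
  shows "Ionescu_Tulcea (step_kernel M \<pi> x) (\<lambda>_. SX M \<Otimes>\<^sub>M SA M)"
  using step_kernel_measurable[OF assms, THEN measurable_prob_algebraD]
    step_kernel_measurable[OF assms, THEN measurable_space]
  by (auto intro!: Ionescu_Tulcea.intro simp: space_prob_algebra)

lemma emeasure_mdp_law:
  assumes "is_reach_mdp M" "\<pi> \<in> policies M" "x \<in> states M"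
    and "B \<in> sets (PiM {0..<n} (\<lambda>_. SX M \<Otimes>\<^sub>M SA M))"
  shows "emeasure (mdp_law M \<pi> x) (prod_emb UNIV (\<lambda>_. SX M \<Otimes>\<^sub>M SA M) {0..<n} B) =
    emeasure (Ionescu_Tulcea.C (step_kernel M \<pi> x) (\<lambda>_. SX M \<Otimes>\<^sub>M SA M) 0 n (\<lambda>_. undefined)) B"
proof -
  interpret Ionescu_Tulcea "step_kernel M \<pi> x" "\<lambda>_. SX M \<Otimes>\<^sub>M SA M"
    by (rule Ionescu_Tulcea_step_kernel[OF assms(1-3)])
  have "prod_emb {0..<n} (\<lambda>_. SX M \<Otimes>\<^sub>M SA M) {0..<n} B = B"
    using sets.sets_into_space[OF assms(4)] by (intro prod_emb_id) (auto simp: space_PiM)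
  then show ?thesis
    using lim[of "{0..<n}" B] emeasure_CI[of "{0..<n}" n B] assms(4) by (simp add: mdp_law_def)
qed

end

theory Submission
  imports Defs
begin

text \<open>
  Value iteration started from \<open>\<one>\<^sub>O\<close> stays within the Borel functions: integrals against a strongly
  Feller kernel are continuous in the state-action pair, so maximising them over the compact-valued,
  upper hemicontinuous feasible sets gives upper semicontinuous functions, and the sets of maximisers
  admit measurable selectors.  Playing the selectors backwards in time shows that the \<open>n\<close>-th iterate
  lies below \<open>V\<^sup>*\<close>; the limit of the iterates is excessive, so optional stopping shows that it
  dominates every \<open>V(\<pi>, \<cdot>)\<close>.  Hence \<open>V\<^sup>*\<close> is Borel and excessive.

  Pathwise \<open>\<zeta>\<^sub>n\<close> is \<open>V\<^sup>*\<close> at the state stopped when the process is killed, and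
  \<open>E[\<zeta>\<^bsub>n+1\<^esub> | h\<^sub>n, a\<^sub>n] = \<zeta>\<^sub>n - D\<^sub>n\<close> where \<open>D\<^sub>n \<ge> 0\<close> is the amount by which \<open>a\<^sub>n\<close> fails to conserve
  \<open>V\<^sup>*\<close>.  Each of the three conditions says that \<open>D\<^sub>n = 0\<close> almost surely for all \<open>n\<close>.
\<close>

section \<open>Measurable maximisers\<close>

text \<open>\<open>Vstar M\<close> is a supremum over an uncountable family of policies, so its
  definition gives no reason for it to be Borel, although both the conservation equation and the
  filtration call for that. Writing it as the countable limit \<open>vlim\<close> settles this and
  also stands in for the dynamic programming principle: excessiveness passes from the iterates to
  the limit, so policies are never pasted together and no optimal policy has to exist. The iterates
  are in general merely Borel, the first one being an indicator; hence the kernel must send bounded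
  measurable functions, not only continuous ones, to continuous functions of the pair.

  The path law comes from Ionescu-Tulcea, so conditional expectations enter in weak form, as
  integrals against indicators of events of the first \<open>Suc n\<close> coordinates. These events
  may involve the action at time \<open>n\<close>, which \<open>hist n\<close> omits.

  The three conditions meet because D_n has a sign: its mean vanishes only if D_n vanishes almost
  surely. Thus thriftiness, which controls only means, already forces pointwise
  conservation.\<close>

lemma upper_hemicontinuous_hit_closed:
  fixes f :: "'x::topological_space \<times> 'a::topological_space \<Rightarrow> real"
  assumes uhc: "upper_hemicontinuous_on S E \<Psi>"
    and compact: "\<And>x. x \<in> S \<Longrightarrow> compact (\<Psi> x)"
    and sub: "\<And>x. x \<in> S \<Longrightarrow> \<Psi> x \<subseteq> E"
    and cont: "continuous_on {(x, a). x \<in> S \<and> a \<in> \<Psi> x} f"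
    and C: "closed C"
  shows "closedin (top_of_set S) {x \<in> S. \<exists>a\<in>\<Psi> x \<inter> C. c \<le> f (x, a)}"
proof -
  let ?H = "{x \<in> S. \<exists>a\<in>\<Psi> x \<inter> C. c \<le> f (x, a)}" and ?G = "{(x, a). x \<in> S \<and> a \<in> \<Psi> x}"
  have "closedin (top_of_set ?G) (?G \<inter> f -` {c..})"
    by (rule continuous_closedin_preimage[OF cont]) simp
  \<comment> \<open>\<open>f\<close> is continuous on the graph only. Writing its upper level set as
    the trace of a closed set of the whole product gives an open complement to which the tube lemma
    applies.\<close>
  then obtain T0 where T0: "closed T0" "?G \<inter> f -` {c..} = ?G \<inter> T0"
    by (auto simp: closedin_closed)
  define T where "T = T0 \<inter> (UNIV \<times> C)"
  have T: "closed T" "(?G \<inter> f -` {c..}) \<inter> (UNIV \<times> C) = ?G \<inter> T"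
    using T0 C by (auto simp: T_def intro!: closed_Int closed_Times)
  \<comment> \<open>The compact slice over \<open>x\<close> avoids \<open>T\<close>; the tube lemma
    thickens it to a box avoiding \<open>T\<close>, and upper hemicontinuity keeps all nearby slices
    inside the side \<open>V\<close> of that box.\<close>
  have "\<exists>W. openin (top_of_set S) W \<and> x \<in> W \<and> W \<subseteq> S - ?H" if x: "x \<in> S - ?H" for x
  proof -
    have "{x} \<times> \<Psi> x \<subseteq> - T"
      using x T(2) by (auto simp: set_eq_iff)
    moreover have "compactin euclidean (\<Psi> x)" "openin (prod_topology euclidean euclidean) (- T)"
      using compact x T(1) by (simp_all add: euclidean_product_topology open_Compl)
    ultimately obtain U V where UV: "open U" "open V" "x \<in> U" "\<Psi> x \<subseteq> V" "U \<times> V \<subseteq> - T"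
      using Wallace_theorem_prod_topology[of euclidean "{x}" euclidean "\<Psi> x" "- T"]
      by (metis compactin_euclidean_iff compact_sing insert_subset open_openin)
    have EV: "openin (top_of_set E) (E \<inter> V)" "\<Psi> x \<subseteq> E \<inter> V"
      using UV(2,4) sub[of x] x by (simp_all add: openin_open_Int)
    moreover have "x \<in> S"
      using x by simp
    ultimately have "\<exists>W. openin (top_of_set S) W \<and> x \<in> W \<and> (\<forall>z\<in>W. \<Psi> z \<subseteq> E \<inter> V)"
      by (intro uhc[unfolded upper_hemicontinuous_on_def, rule_format]) simp_all
    then obtain W where W: "openin (top_of_set S) W" "x \<in> W" "\<And>z. z \<in> W \<Longrightarrow> \<Psi> z \<subseteq> E \<inter> V"
      by metis
    have "W \<inter> U \<subseteq> S - ?H"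
    proof
      fix z assume z: "z \<in> W \<inter> U"
      have "z \<in> S"
        using z W(1) openin_subset by fastforce
      moreover have "f (z, a) < c" if "a \<in> \<Psi> z" "a \<in> C" for a
      proof -
        have "(z, a) \<notin> T"
          using z W(3)[of z] UV(5) that by blast
        then have "\<not> c \<le> f (z, a)"
          using T(2) \<open>z \<in> S\<close> that by (auto simp: set_eq_iff)
        then show ?thesis
          by simp
      qed
      ultimately show "z \<in> S - ?H"
        by (force simp: not_le)
    qed
    then show ?thesis
      using W UV by (intro exI[of _ "W \<inter> U"]) (auto intro: openin_Int_open)
  qed
  then have "openin (top_of_set S) (S - ?H)"
    by (subst openin_subopen) blast
  then show ?thesis
    by (auto simp: closedin_def)
qed

text \<open>Kuratowski--Ryll-Nardzewski: successive approximation along a dense sequence.\<close>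

lemma measurable_selection_closed:
  fixes F :: "'x \<Rightarrow> 'a::polish_space set"
  assumes closed: "\<And>x. x \<in> space N \<Longrightarrow> closed (F x)"
    and nonempty: "\<And>x. x \<in> space N \<Longrightarrow> F x \<noteq> {}"
    and hit: "\<And>C. closed C \<Longrightarrow> {x \<in> space N. F x \<inter> C \<noteq> {}} \<in> sets N"
  obtains s where "s \<in> N \<rightarrow>\<^sub>M borel" "\<And>x. x \<in> space N \<Longrightarrow> s x \<in> F x"
proof -
  obtain D :: "'a set" where D: "countable D" "\<And>U. open U \<Longrightarrow> U \<noteq> {} \<Longrightarrow> \<exists>d\<in>D. d \<in> U"
    using countable_dense_exists by blast
  have "D \<noteq> {}"
    using D(2)[of UNIV] by auto
  define d where "d = from_nat_into D"
  have d: "\<exists>k. dist (d k) a < e" if e: "e > 0" for a e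
  proof -
    obtain b where "b \<in> D" "b \<in> ball a e"
      using D(2)[OF open_ball, of a e] centre_in_ball[of a e] e by blast
    then show ?thesis
      using from_nat_into_surj[OF D(1), of b] by (auto simp: d_def dist_commute)
  qed
  define r where "r n = (1/2 :: real) ^ n" for n :: nat
  \<comment> \<open>\<open>c n x\<close> is an intersection of \<open>n\<close> closed balls that
    still meets \<open>F x\<close>; the next centre is the first dense point whose ball of radius
    \<open>r n\<close> meets what is left. Taking the least index keeps the choice
    measurable.\<close>
  define c where "c = rec_nat (\<lambda>x. UNIV) (\<lambda>n c x. c x \<inter>
    cball (d (LEAST k. F x \<inter> c x \<inter> cball (d k) (r n) \<noteq> {})) (r n))"
  define k where "k n x = (LEAST k. F x \<inter> c n x \<inter> cball (d k) (r n) \<noteq> {})" for n x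
  have c0: "c 0 x = UNIV" and cS: "c (Suc n) x = c n x \<inter> cball (d (k n x)) (r n)" for n x
    by (simp_all add: c_def k_def)
  have ex: "\<exists>j. F x \<inter> c n x \<inter> cball (d j) (r n) \<noteq> {}" if ne: "F x \<inter> c n x \<noteq> {}" for n x
  proof -
    obtain a where a: "a \<in> F x \<inter> c n x"
      using ne by auto
    have "r n > 0" by (simp add: r_def)
    from d[OF this, of a] obtain j where "dist (d j) a < r n" by auto
    then show ?thesis
      using a by (auto intro!: exI[of _ j])
  qed
  have ne: "F x \<inter> c n x \<noteq> {}" if "x \<in> space N" for n x
  proof (induction n)
    case 0
    then show ?case using nonempty[OF that] by (simp add: c0)
  next
    case (Suc n)
    from LeastI_ex[OF ex[OF this]] show ?case
      by (simp add: cS k_def Int_assoc)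
  qed
  \<comment> \<open>The claim covers all closed \<open>C\<close> at once, because the induction step
    applies it to \<open>cball (d j) (r n) \<inter> C\<close>. That step splits according to the
    value \<open>j\<close> of \<open>k n x\<close>, which is decided by hits at stage
    \<open>n\<close>.\<close>
  have hit_c: "{x \<in> space N. F x \<inter> c n x \<inter> C \<noteq> {}} \<in> sets N" (is "?h n C \<in> _") if "closed C" for n C
    using that
  proof (induction n arbitrary: C)
    case 0
    then show ?case using hit by (simp add: c0)
  next
    case (Suc n)
    have "{x \<in> space N. F x \<inter> c (Suc n) x \<inter> C \<noteq> {}} =
      (\<Union>j. (?h n (cball (d j) (r n)) - (\<Union>i<j. ?h n (cball (d i) (r n)))) \<inter> ?h n (cball (d j) (r n) \<inter> C))"
      (is "?l = ?r")
    proof (intro set_eqI iffI)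
      fix x assume x: "x \<in> ?l"
      then have xN: "x \<in> space N" by simp
      have "F x \<inter> c n x \<inter> cball (d (k n x)) (r n) \<noteq> {}"
        using LeastI_ex[OF ex[OF ne[OF xN]]] by (simp add: k_def)
      moreover have "F x \<inter> c n x \<inter> cball (d i) (r n) = {}" if "i < k n x" for i
        using not_less_Least[OF that[unfolded k_def]] by simp
      ultimately show "x \<in> ?r"
        using x by (auto simp: cS)
    next
      fix x assume "x \<in> ?r"
      then obtain j where xN: "x \<in> space N" and j: "F x \<inter> c n x \<inter> cball (d j) (r n) \<noteq> {}"
        "\<And>i. i < j \<Longrightarrow> F x \<inter> c n x \<inter> cball (d i) (r n) = {}"
        "F x \<inter> c n x \<inter> (cball (d j) (r n) \<inter> C) \<noteq> {}"
        by auto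
      have "k n x = j"
        unfolding k_def using j by (intro Least_equality) (auto simp: not_less[symmetric])
      then show "x \<in> ?l"
        using j xN by (auto simp: cS)
    qed
    also have "\<dots> \<in> sets N"
      using Suc by (intro sets.countable_UN'' sets.Int sets.Diff sets.countable_UN) (auto intro!: closed_Int Suc)
    finally show ?case .
  qed
  have k_meas: "k n \<in> N \<rightarrow>\<^sub>M count_space UNIV" for n
    unfolding k_def using hit_c[of "cball _ _" n] by (intro measurable_Least) (auto simp: pred_def)
  have dist: "dist (d (k n x)) a \<le> r n" if "a \<in> c (Suc n) x" for a n x
    using that by (simp add: cS)
  have antimono: "c n x \<subseteq> c m x" if "m \<le> n" for m n x
    using that by (induction rule: dec_induct) (auto simp: cS)
  have "Cauchy (\<lambda>n. d (k n x))" if "x \<in> space N" for x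
  proof (rule metric_CauchyI)
    fix e :: real assume "e > 0"
    then obtain m where m: "r m < e / 2"
      unfolding r_def using real_arch_pow_inv[of "e/2" "1/2"] by auto
    have "dist (d (k i x)) (d (k j x)) < e" if "i \<ge> m" "j \<ge> m" for i j
    proof -
      obtain a where "a \<in> c (Suc (max i j)) x"
        using ne[OF \<open>x \<in> space N\<close>, of "Suc (max i j)"] by auto
      then have "dist (d (k i x)) a \<le> r i" "dist (d (k j x)) a \<le> r j"
        using antimono[of "Suc i" "Suc (max i j)" x] antimono[of "Suc j" "Suc (max i j)" x]
        by (auto intro!: dist)
      moreover have "r i \<le> r m" "r j \<le> r m"
        using that by (auto simp: r_def intro!: power_decreasing)
      ultimately show ?thesis
        using m dist_triangle2[of "d (k i x)" "d (k j x)" a] by linarith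
    qed
    then show "\<exists>M. \<forall>m\<ge>M. \<forall>n\<ge>M. dist (d (k m x)) (d (k n x)) < e"
      by blast
  qed
  then have lim: "(\<lambda>n. d (k n x)) \<longlonglongrightarrow> lim (\<lambda>n. d (k n x))" if "x \<in> space N" for x
    using that by (simp add: Cauchy_convergent_iff convergent_LIMSEQ_iff)
  show thesis
  proof
    show "(\<lambda>x. lim (\<lambda>n. d (k n x))) \<in> N \<rightarrow>\<^sub>M borel"
    proof (rule borel_measurable_LIMSEQ_metric)
      show "(\<lambda>x. d (k n x)) \<in> N \<rightarrow>\<^sub>M borel" for n
        by (rule measurable_compose[OF k_meas]) simp
    qed (rule lim)
    fix x assume x: "x \<in> space N"
    \<comment> \<open>The centres need not belong to \<open>F x\<close>; points \<open>a n\<close>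
      of \<open>F x\<close> within \<open>r n\<close> of them have the same limit, and closedness
      puts it in \<open>F x\<close>.\<close>
    have "\<forall>n. \<exists>a. a \<in> F x \<and> dist (d (k n x)) a \<le> r n"
      using ne[OF x] dist by (metis IntE ex_in_conv)
    then obtain a where a: "\<And>n. a n \<in> F x" "\<And>n. dist (d (k n x)) (a n) \<le> r n"
      by metis
    have rlim: "(\<lambda>n. r n + dist (d (k n x)) (lim (\<lambda>n. d (k n x)))) \<longlonglongrightarrow> 0 + 0"
      unfolding r_def using lim[OF x]
      by (intro tendsto_add LIMSEQ_power_zero) (simp_all add: tendsto_dist_iff[symmetric])
    have "dist (a n) (lim (\<lambda>n. d (k n x))) \<le> r n + dist (d (k n x)) (lim (\<lambda>n. d (k n x)))" for n
      by (rule order_trans[OF dist_triangle3 add_right_mono[OF a(2)]])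
    then have "(\<lambda>n. dist (a n) (lim (\<lambda>n. d (k n x)))) \<longlonglongrightarrow> 0"
      by (intro Lim_null_comparison[OF always_eventually rlim[simplified]] allI) simp
    then have "a \<longlonglongrightarrow> lim (\<lambda>n. d (k n x))"
      by (simp add: tendsto_dist_iff[of a])
    then show "lim (\<lambda>n. d (k n x)) \<in> F x"
      using closed_sequentially[OF closed[OF x]] a(1) by blast
  qed
qed

text \<open>Berge's maximum argument plus a selector. Level sets of the maximum are hit sets with
  \<open>C = UNIV\<close>, hence relatively closed; the maximisers form a closed subset of each
  slice, so the selection lemma applies once their hit sets are shown measurable.\<close>

lemma upper_hemicontinuous_maximum:
  fixes f :: "'x::topological_space \<times> 'a::polish_space \<Rightarrow> real"
  assumes uhc: "upper_hemicontinuous_on S E \<Psi>"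
    and compact: "\<And>x. x \<in> S \<Longrightarrow> compact (\<Psi> x)"
    and nonempty: "\<And>x. x \<in> S \<Longrightarrow> \<Psi> x \<noteq> {}"
    and sub: "\<And>x. x \<in> S \<Longrightarrow> \<Psi> x \<subseteq> E"
    and cont: "continuous_on {(x, a). x \<in> S \<and> a \<in> \<Psi> x} f"
  obtains s where "s \<in> restrict_space borel S \<rightarrow>\<^sub>M borel" "\<And>x. x \<in> S \<Longrightarrow> s x \<in> \<Psi> x"
    "\<And>x. x \<in> S \<Longrightarrow> f (x, s x) = (SUP a\<in>\<Psi> x. f (x, a))"
    "(\<lambda>x. SUP a\<in>\<Psi> x. f (x, a)) \<in> borel_measurable (restrict_space borel S)"
proof -
  let ?N = "restrict_space borel S :: 'x measure"
  define u where "u x = (SUP a\<in>\<Psi> x. f (x, a))" for x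
  have space: "space ?N = S"
    by (simp add: space_restrict_space)
  have cont_x: "continuous_on (\<Psi> x) (\<lambda>a. f (x, a))" if "x \<in> S" for x
    using that by (intro continuous_on_compose2[OF cont] continuous_intros) auto
  have hit_ge: "{x \<in> S. \<exists>a\<in>\<Psi> x \<inter> C. c \<le> f (x, a)} \<in> sets ?N" if C: "closed C" for C c
  proof -
    obtain T where "closed T" "{x \<in> S. \<exists>a\<in>\<Psi> x \<inter> C. c \<le> f (x, a)} = S \<inter> T"
      using upper_hemicontinuous_hit_closed[OF uhc compact sub cont C, of c]
      by (auto simp: closedin_closed)
    then show ?thesis
      by (auto simp: sets_restrict_space)
  qed
  have bdd: "bdd_above ((\<lambda>a. f (x, a)) ` \<Psi> x)" if "x \<in> S" for x
    using compact_continuous_image[OF cont_x compact] that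
    by (simp add: bounded_imp_bdd_above compact_imp_bounded)
  have attain: "\<exists>a\<in>\<Psi> x. f (x, a) = u x" if x: "x \<in> S" for x
  proof -
    obtain a where a: "a \<in> \<Psi> x" "\<And>b. b \<in> \<Psi> x \<Longrightarrow> f (x, b) \<le> f (x, a)"
      using continuous_attains_sup[OF compact[OF x] nonempty[OF x] cont_x[OF x]] by blast
    then have "u x = f (x, a)"
      unfolding u_def by (intro cSup_eq_maximum) auto
    then show ?thesis
      using a by auto
  qed
  have le_u: "f (x, a) \<le> u x" if "x \<in> S" "a \<in> \<Psi> x" for x a
    unfolding u_def by (rule cSUP_upper[OF that(2) bdd[OF that(1)]])
  have u_ge: "{x \<in> S. c \<le> u x} \<in> sets ?N" for c
  proof -
    have "{x \<in> S. c \<le> u x} = {x \<in> S. \<exists>a\<in>\<Psi> x \<inter> UNIV. c \<le> f (x, a)}"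
    proof (intro Collect_cong conj_cong refl iffI)
      fix x assume x: "x \<in> S" and "c \<le> u x"
      then show "\<exists>a\<in>\<Psi> x \<inter> UNIV. c \<le> f (x, a)"
        using attain[OF x] by (metis Int_UNIV_right)
    next
      fix x assume x: "x \<in> S" and "\<exists>a\<in>\<Psi> x \<inter> UNIV. c \<le> f (x, a)"
      then show "c \<le> u x"
        using le_u[OF x] by (auto intro: order_trans)
    qed
    then show ?thesis
      using hit_ge[of UNIV c] by simp
  qed
  then have u_meas: "u \<in> borel_measurable ?N"
    by (simp add: borel_measurable_iff_ge space)
  define F where "F x = {a \<in> \<Psi> x. f (x, a) = u x}" for x
  have hit: "{x \<in> space ?N. F x \<inter> C \<noteq> {}} \<in> sets ?N" if C: "closed C" for C
  proof -
    let ?H = "\<lambda>c. {x \<in> S. \<exists>a\<in>\<Psi> x \<inter> C. c \<le> f (x, a)}"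
    \<comment> \<open>\<open>F x\<close> meets \<open>C\<close> exactly when the supremum over
      \<open>\<Psi> x \<inter> C\<close> is as large as \<open>u x\<close>. Testing with rationals
      up to \<open>u x\<close> makes this a countable intersection; compactness of
      \<open>\<Psi> x \<inter> C\<close> turns approximate maximisers into a maximiser.\<close>
    have "{x \<in> space ?N. F x \<inter> C \<noteq> {}} = (\<Inter>q::rat. {x \<in> S. u x < of_rat q} \<union> ?H (of_rat q))"
      (is "?l = ?r")
    proof (intro set_eqI iffI)
      fix x assume "x \<in> ?l"
      then obtain a where "x \<in> S" "a \<in> \<Psi> x \<inter> C" "f (x, a) = u x"
        by (auto simp: space F_def)
      then show "x \<in> ?r"
        by (auto simp: not_less intro!: bexI[of _ a])
    next
      fix x assume x: "x \<in> ?r"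
      then have xS: "x \<in> S"
        by auto
      have hit_q: "\<exists>a\<in>\<Psi> x \<inter> C. of_rat q \<le> f (x, a)" if "of_rat q \<le> u x" for q
        using x that by (auto simp: not_less[symmetric])
      \<comment> \<open>Some rational below \<open>u x\<close> shows that
        \<open>\<Psi> x \<inter> C\<close> is nonempty; only then can the maximum over it be
        taken.\<close>
      obtain q0 :: rat where "of_rat q0 < u x"
        using of_rat_dense[of "u x - 1" "u x"] by auto
      then have "\<Psi> x \<inter> C \<noteq> {}"
        using hit_q[of q0] by auto
      then obtain a where a: "a \<in> \<Psi> x \<inter> C" "\<And>b. b \<in> \<Psi> x \<inter> C \<Longrightarrow> f (x, b) \<le> f (x, a)"
        using continuous_attains_sup[of "\<Psi> x \<inter> C" "\<lambda>a. f (x, a)"] compact[OF xS] C cont_x[OF xS]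
        by (meson Int_lower1 compact_Int_closed continuous_on_subset)
      have "u x \<le> f (x, a)"
      proof (rule ccontr)
        assume "\<not> u x \<le> f (x, a)"
        then obtain q :: rat where "f (x, a) < of_rat q" "of_rat q < u x"
          using of_rat_dense[of "f (x, a)" "u x"] by auto
        then show False
          using hit_q[of q] a(2) by fastforce
      qed
      then show "x \<in> ?l"
        using a le_u[OF xS, of a] xS by (auto simp: F_def space)
    qed
    also have "\<dots> \<in> sets ?N"
    proof -
      have "{x \<in> S. u x < of_rat q} \<in> sets ?N" for q
        using measurable_sets[OF u_meas, of "{..< of_rat q}"]
        by (simp add: space vimage_def Int_def conj_commute)
      then show ?thesis
        using hit_ge[OF C] by (intro sets.countable_INT') auto
    qed
    finally show ?thesis .
  qed
  have closed_F: "closed (F x)" if "x \<in> S" for x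
  proof -
    have "F x = \<Psi> x \<inter> (\<lambda>a. f (x, a)) -` {u x}"
      by (auto simp: F_def)
    then show ?thesis
      using continuous_closed_preimage[OF cont_x[OF that] compact_imp_closed[OF compact[OF that]]]
      by simp
  qed
  have ne_F: "F x \<noteq> {}" if "x \<in> S" for x
    using attain[OF that] by (auto simp: F_def)
  obtain s where s: "s \<in> ?N \<rightarrow>\<^sub>M borel" "\<And>x. x \<in> S \<Longrightarrow> s x \<in> F x"
    using measurable_selection_closed[of ?N F, unfolded space, OF closed_F ne_F hit[unfolded space]] by blast
  show thesis
    using s u_meas by (intro that[of s]) (simp_all add: F_def u_def[abs_def])
qed

section \<open>The one-step law\<close>

lemma space_SX: "space (SX M) = states M"
  by (simp add: SX_def space_restrict_space)

lemma space_SA: "space (SA M) = actions M"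
  by (simp add: SA_def space_restrict_space)

locale reach_model =
  fixes M :: "('x::polish_space, 'a::polish_space) reach_mdp"
  assumes mdp: "is_reach_mdp M"
begin

abbreviation "XA \<equiv> SX M \<Otimes>\<^sub>M SA M"

lemma target_subset: "target M \<subseteq> region M"
  and region_subset: "region M \<subseteq> states M"
  and sets_target[measurable]: "target M \<in> sets (SX M)"
  and sets_live_states[measurable]: "live_states M \<in> sets (SX M)"
  using mdp sets.sets_into_space[of "region M" "SX M"]
  by (auto simp: is_reach_mdp_def live_states_def space_SX)

lemma trans_total_space: "p \<in> space XA \<Longrightarrow> trans_total M p \<in> space (prob_algebra (SX M))"
  by (rule measurable_space[OF trans_total_measurable[OF mdp]])

lemma prob_space_trans_total: "p \<in> space XA \<Longrightarrow> prob_space (trans_total M p)"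
  and sets_trans_total: "p \<in> space XA \<Longrightarrow> sets (trans_total M p) = sets (SX M)"
  and space_trans_total: "p \<in> space XA \<Longrightarrow> space (trans_total M p) = states M"
  using trans_total_space[of p] sets_eq_imp_space_eq[of "trans_total M p" "SX M"]
  by (simp_all add: space_prob_algebra space_SX)

lemma integrable_trans_total:
  fixes w :: "'x \<Rightarrow> real"
  assumes "p \<in> space XA" "w \<in> borel_measurable (SX M)" "\<And>y. y \<in> states M \<Longrightarrow> 0 \<le> w y \<and> w y \<le> 1"
  shows "integrable (trans_total M p) w"
proof -
  interpret prob_space "trans_total M p"
    by (rule prob_space_trans_total[OF assms(1)])
  show ?thesis
    using assms space_trans_total[OF assms(1)] sets_trans_total[OF assms(1)]
    by (intro integrable_const_bound[of _ 1] AE_I2) (auto cong: measurable_cong_sets)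
qed

lemma integral_trans_total_bounds:
  fixes w :: "'x \<Rightarrow> real"
  assumes "p \<in> space XA" "w \<in> borel_measurable (SX M)" "\<And>y. y \<in> states M \<Longrightarrow> 0 \<le> w y \<and> w y \<le> 1"
  shows "0 \<le> (\<integral>y. w y \<partial>trans_total M p)" "(\<integral>y. w y \<partial>trans_total M p) \<le> 1"
proof -
  interpret prob_space "trans_total M p"
    by (rule prob_space_trans_total[OF assms(1)])
  show "0 \<le> (\<integral>y. w y \<partial>trans_total M p)" "(\<integral>y. w y \<partial>trans_total M p) \<le> 1"
    using assms space_trans_total[OF assms(1)] integrable_trans_total[OF assms]
    by (auto intro!: integral_nonneg_AE integral_le_const AE_I2)
qed

end

section \<open>Path law and its one-step disintegration\<close>

locale reach_process = reach_model M
  for M :: "('x::polish_space, 'a::polish_space) reach_mdp" +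
  fixes \<pi> :: "('x, 'a) policy" and x :: 'x
  assumes policy: "\<pi> \<in> policies M" and x: "x \<in> states M"
begin

abbreviation "P \<equiv> mdp_law M \<pi> x"
abbreviation "past n \<omega> \<equiv> restrict \<omega> {0..<n}" for n :: nat and \<omega> :: "nat \<Rightarrow> 'x \<times> 'a"

sublocale IT: Ionescu_Tulcea "step_kernel M \<pi> x" "\<lambda>_. XA"
  by (rule Ionescu_Tulcea_step_kernel[OF mdp policy x])

lemma space_law: "space P = space (PiM UNIV (\<lambda>_. XA))"
  and sets_law[measurable_cong]: "sets P = sets (PiM UNIV (\<lambda>_. XA))"
  by (simp_all add: mdp_law_def)

lemma measurable_past[measurable]: "past n \<in> PiM UNIV (\<lambda>_. XA) \<rightarrow>\<^sub>M PiM {0..<n} (\<lambda>_. XA)"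
  by (rule measurable_restrict_subset) simp

lemma measurable_past_le: "m \<le> n \<Longrightarrow> past m \<in> PiM {0..<n} (\<lambda>_. XA) \<rightarrow>\<^sub>M PiM {0..<m} (\<lambda>_. XA)"
  by (rule measurable_restrict_subset) simp

lemma measurable_st[measurable]: "st n \<in> PiM UNIV (\<lambda>_. XA) \<rightarrow>\<^sub>M SX M"
  and measurable_ac[measurable]: "ac n \<in> PiM UNIV (\<lambda>_. XA) \<rightarrow>\<^sub>M SA M"
  unfolding st_def[abs_def] ac_def[abs_def] by measurable

text \<open>Every measurable set of the finite product is the base of a cylinder, and
  \<open>emeasure_mdp_law\<close> evaluates those. Integrals of functions of finitely many
  coordinates thereby become iterated kernel integrals.\<close>

lemma distr_past: "distr P (PiM {0..<n} (\<lambda>_. XA)) (past n) = IT.C 0 n (\<lambda>_. undefined)"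
proof (rule measure_eqI)
  show "sets (distr P (PiM {0..<n} (\<lambda>_. XA)) (past n)) = sets (IT.C 0 n (\<lambda>_. undefined))"
    by (subst IT.sets_C) (simp_all add: space_PiM)
  fix B assume "B \<in> sets (distr P (PiM {0..<n} (\<lambda>_. XA)) (past n))"
  then have B: "B \<in> sets (PiM {0..<n} (\<lambda>_. XA))"
    by simp
  show "emeasure (distr P (PiM {0..<n} (\<lambda>_. XA)) (past n)) B = emeasure (IT.C 0 n (\<lambda>_. undefined)) B"
    unfolding emeasure_mdp_law[OF mdp policy x B, symmetric]
    using B by (subst emeasure_distr) (auto simp: prod_emb_def space_law space_PiM)
qed

sublocale prob_space P
proof -
  have "prob_space (distr P (PiM {0..<0} (\<lambda>_. XA)) (past 0))"
    unfolding distr_past by (rule IT.prob_space_C) simp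
  then show "prob_space P"
    by (rule prob_space_distrD[rotated]) measurable
qed

lemma nn_integral_past:
  assumes [measurable]: "f \<in> borel_measurable (PiM {0..<n} (\<lambda>_. XA))"
  shows "(\<integral>\<^sup>+\<omega>. f (past n \<omega>) \<partial>P) = (\<integral>\<^sup>+\<eta>. f \<eta> \<partial>IT.C 0 n (\<lambda>_. undefined))"
  unfolding distr_past[symmetric] by (subst nn_integral_distr) simp_all

text \<open>\<open>IT.eP n\<close> extends a segment by one sample of \<open>step_kernel\<close>;
  peeling it off and returning to the path law amounts to conditioning on the first \<open>n\<close>
  coordinates.\<close>

lemma nn_integral_step:
  assumes f: "f \<in> borel_measurable (PiM {0..<Suc n} (\<lambda>_. XA))"
  shows "(\<integral>\<^sup>+\<omega>. f (past (Suc n) \<omega>) \<partial>P) =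
    (\<integral>\<^sup>+\<omega>. (\<integral>\<^sup>+z. f ((past n \<omega>)(n := z)) \<partial>step_kernel M \<pi> x n (past n \<omega>)) \<partial>P)"
proof -
  have eP: "IT.eP n \<in> PiM {0..<n} (\<lambda>_. XA) \<rightarrow>\<^sub>M subprob_algebra (PiM {0..<Suc n} (\<lambda>_. XA))"
    by simp
  have "(\<integral>\<^sup>+\<omega>. f (past (Suc n) \<omega>) \<partial>P) = (\<integral>\<^sup>+\<eta>. (\<integral>\<^sup>+\<eta>'. f \<eta>' \<partial>IT.eP n \<eta>) \<partial>IT.C 0 n (\<lambda>_. undefined))"
    using eP unfolding nn_integral_past[OF f] IT.C.simps
    by (subst nn_integral_bind[OF f]) (simp_all add: IT.sets_C cong: measurable_cong_sets)
  also have "\<dots> = (\<integral>\<^sup>+\<omega>. (\<integral>\<^sup>+\<eta>'. f \<eta>' \<partial>IT.eP n (past n \<omega>)) \<partial>P)"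
    using f eP by (subst nn_integral_past) simp_all
  also have "\<dots> = (\<integral>\<^sup>+\<omega>. (\<integral>\<^sup>+z. f ((past n \<omega>)(n := z)) \<partial>step_kernel M \<pi> x n (past n \<omega>)) \<partial>P)"
    using measurable_space[OF measurable_past, of _ n]
    by (intro nn_integral_cong IT.nn_integral_eP f) (simp add: space_law)
  finally show ?thesis .
qed

text \<open>The state half of \<open>step_kernel\<close>. The separate name lets the initial draw
  and the later transitions share one Fubini-type formula.\<close>

definition state_kernel :: "nat \<Rightarrow> (nat \<Rightarrow> 'x \<times> 'a) \<Rightarrow> 'x measure" where
  "state_kernel n \<eta> = (if n = 0 then return (SX M) x else trans_total M (\<eta> (n - 1)))"

lemma space_state_kernel:
  assumes "\<eta> \<in> space (PiM {0..<n} (\<lambda>_. XA))"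
  shows "state_kernel n \<eta> \<in> space (prob_algebra (SX M))"
proof (cases n)
  case 0
  then show ?thesis
    using x by (simp add: state_kernel_def space_prob_algebra prob_space_return space_SX)
next
  case (Suc m)
  then have "\<eta> m \<in> space XA"
    using assms by (auto simp: space_PiM)
  then show ?thesis
    using measurable_space[OF trans_total_measurable[OF mdp]] Suc by (simp add: state_kernel_def)
qed

lemma nn_integral_step_kernel:
  assumes g[measurable]: "g \<in> borel_measurable XA" and \<eta>: "\<eta> \<in> space (PiM {0..<n} (\<lambda>_. XA))"
  shows "(\<integral>\<^sup>+z. g z \<partial>step_kernel M \<pi> x n \<eta>) =
    (\<integral>\<^sup>+y. (\<integral>\<^sup>+a. g (y, a) \<partial>act_kernel M \<pi> n (\<eta>, y)) \<partial>state_kernel n \<eta>)"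
proof -
  have sets: "sets (state_kernel n \<eta>) = sets (SX M)"
    using space_state_kernel[OF \<eta>] by (simp add: space_prob_algebra)
  have act: "(\<lambda>y. act_kernel M \<pi> n (\<eta>, y)) \<in> SX M \<rightarrow>\<^sub>M prob_algebra (SA M)"
    by (rule measurable_compose[OF _ act_kernel_measurable[OF mdp policy]])
      (use \<eta> in \<open>simp add: hist_space_def\<close>)
  have k: "(\<lambda>y. act_kernel M \<pi> n (\<eta>, y) \<bind> (\<lambda>a. return XA (y, a))) \<in> SX M \<rightarrow>\<^sub>M prob_algebra XA"
    by (rule measurable_bind_prob_space2[OF act]) simp
  have "(\<integral>\<^sup>+z. g z \<partial>step_kernel M \<pi> x n \<eta>) =
    (\<integral>\<^sup>+y. (\<integral>\<^sup>+z. g z \<partial>(act_kernel M \<pi> n (\<eta>, y) \<bind> (\<lambda>a. return XA (y, a)))) \<partial>state_kernel n \<eta>)"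
    unfolding step_kernel_def state_kernel_def[symmetric]
    by (rule nn_integral_bind[OF g])
      (use measurable_prob_algebraD[OF k] sets in \<open>simp cong: measurable_cong_sets\<close>)
  also have "\<dots> = (\<integral>\<^sup>+y. (\<integral>\<^sup>+a. g (y, a) \<partial>act_kernel M \<pi> n (\<eta>, y)) \<partial>state_kernel n \<eta>)"
  proof (intro nn_integral_cong)
    fix y assume "y \<in> space (state_kernel n \<eta>)"
    then have y: "y \<in> space (SX M)"
      using sets_eq_imp_space_eq[OF sets] by simp
    have sets_act: "sets (act_kernel M \<pi> n (\<eta>, y)) = sets (SA M)"
      using measurable_space[OF act y] by (simp add: space_prob_algebra)
    have "(\<lambda>a. return XA (y, a)) \<in> SA M \<rightarrow>\<^sub>M subprob_algebra XA"
      using y by simp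
    then have "(\<integral>\<^sup>+z. g z \<partial>(act_kernel M \<pi> n (\<eta>, y) \<bind> (\<lambda>a. return XA (y, a)))) =
      (\<integral>\<^sup>+a. (\<integral>\<^sup>+z. g z \<partial>return XA (y, a)) \<partial>act_kernel M \<pi> n (\<eta>, y))"
      using sets_act by (intro nn_integral_bind[OF g]) (simp cong: measurable_cong_sets)
    also have "\<dots> = (\<integral>\<^sup>+a. g (y, a) \<partial>act_kernel M \<pi> n (\<eta>, y))"
      using y sets_eq_imp_space_eq[OF sets_act]
      by (intro nn_integral_cong nn_integral_return) (auto simp: space_pair_measure)
    finally show "(\<integral>\<^sup>+z. g z \<partial>(act_kernel M \<pi> n (\<eta>, y) \<bind> (\<lambda>a. return XA (y, a)))) =
      (\<integral>\<^sup>+a. g (y, a) \<partial>act_kernel M \<pi> n (\<eta>, y))" .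
  qed
  finally show ?thesis .
qed

lemma prob_space_act_kernel:
  assumes "h \<in> space (hist_space M n)"
  shows "prob_space (act_kernel M \<pi> n h)" "sets (act_kernel M \<pi> n h) = sets (SA M)"
  using measurable_space[OF act_kernel_measurable[OF mdp policy] assms]
  by (simp_all add: space_prob_algebra)

text \<open>Weak form of the fact that \<open>trans_total M (\<omega> n)\<close> is the law of the
  next state given the first \<open>Suc n\<close> pairs. The action drawn at time
  \<open>Suc n\<close> integrates out, since its kernel has mass one.\<close>

lemma nn_integral_Markov:
  assumes h[measurable]: "h \<in> borel_measurable (PiM {0..<Suc n} (\<lambda>_. XA))"
    and w[measurable]: "w \<in> borel_measurable (SX M)"
  shows "(\<integral>\<^sup>+\<omega>. h (past (Suc n) \<omega>) * w (st (Suc n) \<omega>) \<partial>P) =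
    (\<integral>\<^sup>+\<omega>. h (past (Suc n) \<omega>) * (\<integral>\<^sup>+y. w y \<partial>trans_total M (\<omega> n)) \<partial>P)"
proof -
  let ?f = "\<lambda>\<eta>. h (past (Suc n) \<eta>) * w (fst (\<eta> (Suc n)))"
  note [measurable] = measurable_past_le[of "Suc n" "Suc (Suc n)"]
  have f: "?f \<in> borel_measurable (PiM {0..<Suc (Suc n)} (\<lambda>_. XA))"
    by measurable
  have "(\<integral>\<^sup>+\<omega>. h (past (Suc n) \<omega>) * w (st (Suc n) \<omega>) \<partial>P) = (\<integral>\<^sup>+\<omega>. ?f (past (Suc (Suc n)) \<omega>) \<partial>P)"
    by (simp add: st_def Int_absorb2 restrict_restrict del: restrict_apply) (simp add: restrict_def)
  also have "\<dots> = (\<integral>\<^sup>+\<omega>. (\<integral>\<^sup>+z. ?f ((past (Suc n) \<omega>)(Suc n := z)) \<partial>step_kernel M \<pi> x (Suc n) (past (Suc n) \<omega>)) \<partial>P)"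
    by (rule nn_integral_step[OF f])
  also have "\<dots> = (\<integral>\<^sup>+\<omega>. (\<integral>\<^sup>+z. h (past (Suc n) \<omega>) * w (fst z) \<partial>step_kernel M \<pi> x (Suc n) (past (Suc n) \<omega>)) \<partial>P)"
    by (intro nn_integral_cong arg_cong2[where f="(*)"] arg_cong[where f=h]) (auto simp: restrict_def)
  also have "\<dots> = (\<integral>\<^sup>+\<omega>. h (past (Suc n) \<omega>) * (\<integral>\<^sup>+y. w y \<partial>trans_total M (\<omega> n)) \<partial>P)"
  proof (intro nn_integral_cong)
    fix \<omega> assume "\<omega> \<in> space P"
    then have \<eta>: "past (Suc n) \<omega> \<in> space (PiM {0..<Suc n} (\<lambda>_. XA))"
      using measurable_space[OF measurable_past] by (simp add: space_law)
    have K: "state_kernel (Suc n) (past (Suc n) \<omega>) = trans_total M (\<omega> n)"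
      by (simp add: state_kernel_def)
    then have sets: "sets (trans_total M (\<omega> n)) = sets (SX M)"
      using space_state_kernel[OF \<eta>] by (simp add: space_prob_algebra)
    have "(\<integral>\<^sup>+z. h (past (Suc n) \<omega>) * w (fst z) \<partial>step_kernel M \<pi> x (Suc n) (past (Suc n) \<omega>)) =
      (\<integral>\<^sup>+y. (\<integral>\<^sup>+a. h (past (Suc n) \<omega>) * w y \<partial>act_kernel M \<pi> (Suc n) (past (Suc n) \<omega>, y)) \<partial>trans_total M (\<omega> n))"
      by (subst nn_integral_step_kernel[OF _ \<eta>]) (simp_all add: K)
    also have "\<dots> = (\<integral>\<^sup>+y. h (past (Suc n) \<omega>) * w y \<partial>trans_total M (\<omega> n))"
    proof (intro nn_integral_cong)
      fix y assume "y \<in> space (trans_total M (\<omega> n))"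
      then have "(past (Suc n) \<omega>, y) \<in> space (hist_space M (Suc n))"
        using \<eta> sets_eq_imp_space_eq[OF sets] by (simp add: hist_space_def space_pair_measure)
      from prob_space.emeasure_space_1[OF prob_space_act_kernel(1)[OF this]]
      show "(\<integral>\<^sup>+a. h (past (Suc n) \<omega>) * w y \<partial>act_kernel M \<pi> (Suc n) (past (Suc n) \<omega>, y)) =
        h (past (Suc n) \<omega>) * w y"
        by simp
    qed
    also have "\<dots> = h (past (Suc n) \<omega>) * (\<integral>\<^sup>+y. w y \<partial>trans_total M (\<omega> n))"
      using sets by (intro nn_integral_cmult) (simp cong: measurable_cong_sets)
    finally show "(\<integral>\<^sup>+z. h (past (Suc n) \<omega>) * w (fst z) \<partial>step_kernel M \<pi> x (Suc n) (past (Suc n) \<omega>)) =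
      h (past (Suc n) \<omega>) * (\<integral>\<^sup>+y. w y \<partial>trans_total M (\<omega> n))" .
  qed
  finally show ?thesis .
qed

section \<open>Almost sure properties of actions and of the initial state\<close>

lemma measurable_hist: "hist n \<in> PiM UNIV (\<lambda>_. XA) \<rightarrow>\<^sub>M hist_space M n"
  unfolding hist_def[abs_def] hist_space_def by measurable

text \<open>Transfers a property from the action kernel to the path. The hypothesis is asked of
  every history, so nothing has to be known about the law of the history. Feasibility and the play
  of the selectors are both obtained from it.\<close>

lemma AE_action:
  assumes R: "R \<in> sets (hist_space M n \<Otimes>\<^sub>M SA M)"
    and act: "\<And>h. h \<in> space (hist_space M n) \<Longrightarrow> AE a in act_kernel M \<pi> n h. (h, a) \<in> R"
  shows "AE \<omega> in P. (hist n \<omega>, ac n \<omega>) \<in> R"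
proof -
  let ?f = "\<lambda>\<eta>. indicator (- R) ((past n \<eta>, fst (\<eta> n)), snd (\<eta> n)) :: ennreal"
  have [measurable]: "(\<lambda>\<eta>. ((past n \<eta>, fst (\<eta> n)), snd (\<eta> n)))
      \<in> PiM {0..<Suc n} (\<lambda>_. XA) \<rightarrow>\<^sub>M hist_space M n \<Otimes>\<^sub>M SA M"
    using measurable_past_le[of n "Suc n"] unfolding hist_space_def by measurable
  have [measurable]: "(\<lambda>\<eta>. (hist n \<eta>, ac n \<eta>)) \<in> PiM UNIV (\<lambda>_. XA) \<rightarrow>\<^sub>M hist_space M n \<Otimes>\<^sub>M SA M"
    using measurable_hist by measurable
  \<comment> \<open>The plain complement \<open>- R\<close> need not lie inside the product space;
    its indicator is measurable because on the space it agrees with that of the relative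
    complement.\<close>
  have R': "indicator (- R) \<in> borel_measurable (hist_space M n \<Otimes>\<^sub>M SA M)"
    using R by (subst measurable_cong[of _ _ "indicator (space (hist_space M n \<Otimes>\<^sub>M SA M) - R)"])
      (auto simp: indicator_def)
  have f: "?f \<in> borel_measurable (PiM {0..<Suc n} (\<lambda>_. XA))"
    by (rule measurable_compose[OF _ R']) measurable
  have "(\<integral>\<^sup>+\<omega>. indicator (- R) (hist n \<omega>, ac n \<omega>) \<partial>P) = (\<integral>\<^sup>+\<omega>. ?f (past (Suc n) \<omega>) \<partial>P)"
    by (intro nn_integral_cong arg_cong[where f="indicator (-R)"])
      (auto simp: hist_def st_def ac_def restrict_def)
  also have "\<dots> = (\<integral>\<^sup>+\<omega>. (\<integral>\<^sup>+z. ?f ((past n \<omega>)(n := z)) \<partial>step_kernel M \<pi> x n (past n \<omega>)) \<partial>P)"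
    by (rule nn_integral_step[OF f])
  also have "\<dots> = (\<integral>\<^sup>+\<omega>. (\<integral>\<^sup>+z. indicator (- R) ((past n \<omega>, fst z), snd z) \<partial>step_kernel M \<pi> x n (past n \<omega>)) \<partial>P)"
    by (intro nn_integral_cong arg_cong[where f="indicator (-R)"]) (auto simp: restrict_def)
  also have "\<dots> = (\<integral>\<^sup>+\<omega>. 0 \<partial>P)"
  proof (intro nn_integral_cong)
    fix \<omega> assume "\<omega> \<in> space P"
    then have \<eta>: "past n \<omega> \<in> space (PiM {0..<n} (\<lambda>_. XA))"
      using measurable_space[OF measurable_past] by (simp add: space_law)
    have sets: "sets (state_kernel n (past n \<omega>)) = sets (SX M)"
      using space_state_kernel[OF \<eta>] by (simp add: space_prob_algebra)
    have "(\<lambda>z. indicator (- R) ((past n \<omega>, fst z), snd z) :: ennreal) \<in> borel_measurable XA"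
      by (rule measurable_compose[OF _ R']) (use \<eta> in \<open>simp add: hist_space_def\<close>)
    then have "(\<integral>\<^sup>+z. indicator (- R) ((past n \<omega>, fst z), snd z) \<partial>step_kernel M \<pi> x n (past n \<omega>)) =
      (\<integral>\<^sup>+y. (\<integral>\<^sup>+a. indicator (- R) ((past n \<omega>, y), a) \<partial>act_kernel M \<pi> n (past n \<omega>, y)) \<partial>state_kernel n (past n \<omega>))"
      by (subst nn_integral_step_kernel[OF _ \<eta>]) simp_all
    also have "\<dots> = (\<integral>\<^sup>+y. 0 \<partial>state_kernel n (past n \<omega>))"
    proof (intro nn_integral_cong)
      fix y assume "y \<in> space (state_kernel n (past n \<omega>))"
      then have "(past n \<omega>, y) \<in> space (hist_space M n)"
        using \<eta> sets_eq_imp_space_eq[OF sets] by (simp add: hist_space_def space_pair_measure)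
      from act[OF this]
      have "(\<integral>\<^sup>+a. indicator (- R) ((past n \<omega>, y), a) \<partial>act_kernel M \<pi> n (past n \<omega>, y)) =
        (\<integral>\<^sup>+a. 0 \<partial>act_kernel M \<pi> n (past n \<omega>, y))"
        by (intro nn_integral_cong_AE) (auto elim: eventually_mono)
      then show "(\<integral>\<^sup>+a. indicator (- R) ((past n \<omega>, y), a) \<partial>act_kernel M \<pi> n (past n \<omega>, y)) = 0"
        by simp
    qed
    finally show "(\<integral>\<^sup>+z. indicator (- R) ((past n \<omega>, fst z), snd z) \<partial>step_kernel M \<pi> x n (past n \<omega>)) = 0"
      by simp
  qed
  finally have "(\<integral>\<^sup>+\<omega>. indicator (- R) (hist n \<omega>, ac n \<omega>) \<partial>P) = 0"
    by simp
  moreover have "(\<lambda>\<omega>. indicator (- R) (hist n \<omega>, ac n \<omega>) :: ennreal) \<in> borel_measurable P"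
    by (rule measurable_compose[OF _ R']) measurable
  ultimately have "AE \<omega> in P. indicator (- R) (hist n \<omega>, ac n \<omega>) = (0::ennreal)"
    by (simp add: nn_integral_0_iff_AE)
  then show ?thesis
    by (rule eventually_mono) (auto simp: indicator_def split: if_splits)
qed

text \<open>Live histories use the policy, whose mass on feasible actions is one; all others use
  \<open>after_kill\<close>. On these paths \<open>trans_total\<close> is the genuine transition
  law.\<close>

lemma AE_feasible: "AE \<omega> in P. \<forall>n. \<omega> n \<in> feasible_pairs M"
proof (subst AE_all_countable, intro allI)
  fix n
  have feas: "y \<in> states M \<Longrightarrow> feas M y \<in> sets (SA M)"
    and F: "feasible_pairs M \<in> sets XA"
    and after: "y \<in> states M \<Longrightarrow> after_kill M y \<in> feas M y" 
    "y \<in> states M \<Longrightarrow> after_kill M y \<in> space (SA M)" for y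
    using mdp measurable_space[of "after_kill M" "SX M" "SA M" y] by (auto simp: is_reach_mdp_def space_SX)
  let ?R = "{p \<in> space (hist_space M n \<Otimes>\<^sub>M SA M). (snd (fst p), snd p) \<in> feasible_pairs M}"
  have "AE \<omega> in P. (hist n \<omega>, ac n \<omega>) \<in> ?R"
  proof (rule AE_action)
    show "?R \<in> sets (hist_space M n \<Otimes>\<^sub>M SA M)"
      using F unfolding hist_space_def by measurable
    fix h assume h: "h \<in> space (hist_space M n)"
    then have h2: "snd h \<in> states M"
      by (auto simp: hist_space_def space_pair_measure space_SX)
    interpret act: prob_space "act_kernel M \<pi> n h"
      by (rule prob_space_act_kernel(1)[OF h])
    have "AE a in act_kernel M \<pi> n h. a \<in> feas M (snd h)"
    proof (cases "h \<in> live_hists M n")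
      case True
      then have "measure (\<pi> n h) (feas M (snd h)) = 1"
        using policy by (auto simp: policies_def)
      then show ?thesis
        using True feas[OF h2] prob_space_act_kernel(2)[OF h] by (intro act.AE_prob_1) (simp add: act_kernel_def)
    next
      case False
      then have "act_kernel M \<pi> n h = return (SA M) (after_kill M (snd h))"
        by (simp add: act_kernel_def)
      moreover have "AE a in return (SA M) (after_kill M (snd h)). a \<in> feas M (snd h)"
        using feas[OF h2] after[OF h2] by (subst AE_return) auto
      ultimately show ?thesis
        by (rule ssubst)
    qed
    moreover have "AE a in act_kernel M \<pi> n h. a \<in> space (SA M)"
      using AE_space[of "act_kernel M \<pi> n h"] sets_eq_imp_space_eq[OF prob_space_act_kernel(2)[OF h]] by simp
    ultimately show "AE a in act_kernel M \<pi> n h. (h, a) \<in> ?R"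
      by eventually_elim (use h h2 in \<open>simp add: space_pair_measure feasible_pairs_def\<close>)
  qed
  then show "AE \<omega> in P. \<omega> n \<in> feasible_pairs M"
    by eventually_elim (simp add: hist_def st_def ac_def)
qed

lemma AE_start: "AE \<omega> in P. st 0 \<omega> = x"
proof -
  let ?f = "\<lambda>\<eta>. indicator (- {x}) (fst (\<eta> 0)) :: ennreal"
  have ind[measurable]: "indicator (- {x}) \<in> borel_measurable (SX M)"
    unfolding SX_def by (intro measurable_restrict_space1 borel_measurable_indicator) simp
  have f: "?f \<in> borel_measurable (PiM {0..<Suc 0} (\<lambda>_. XA))"
    by measurable
  have \<eta>: "past 0 \<omega> \<in> space (PiM {0..<0} (\<lambda>_. XA))" for \<omega>
    by (simp add: space_PiM restrict_def)
  have "(\<integral>\<^sup>+\<omega>. indicator (- {x}) (st 0 \<omega>) \<partial>P) = (\<integral>\<^sup>+\<omega>. ?f (past (Suc 0) \<omega>) \<partial>P)"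
    by (simp add: st_def)
  also have "\<dots> = (\<integral>\<^sup>+\<omega>. (\<integral>\<^sup>+z. ?f ((past 0 \<omega>)(0 := z)) \<partial>step_kernel M \<pi> x 0 (past 0 \<omega>)) \<partial>P)"
    by (rule nn_integral_step[OF f])
  also have "\<dots> = (\<integral>\<^sup>+\<omega>. (\<integral>\<^sup>+y. (\<integral>\<^sup>+a. indicator (- {x}) y \<partial>act_kernel M \<pi> 0 (past 0 \<omega>, y)) \<partial>return (SX M) x) \<partial>P)"
    using \<eta> by (subst nn_integral_step_kernel) (simp_all add: state_kernel_def)
  also have "\<dots> = (\<integral>\<^sup>+\<omega>. (\<integral>\<^sup>+y. indicator (- {x}) y \<partial>return (SX M) x) \<partial>P)"
  proof (intro nn_integral_cong)
    fix \<omega> y assume "y \<in> space (return (SX M) x)"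
    then have "(past 0 \<omega>, y) \<in> space (hist_space M 0)"
      using \<eta>[of \<omega>] by (simp add: hist_space_def space_pair_measure)
    from prob_space.emeasure_space_1[OF prob_space_act_kernel(1)[OF this]]
    show "(\<integral>\<^sup>+a. indicator (- {x}) y \<partial>act_kernel M \<pi> 0 (past 0 \<omega>, y)) = (indicator (- {x}) y :: ennreal)"
      by simp
  qed
  also have "\<dots> = 0"
    using x by (subst nn_integral_return) (simp_all add: space_SX)
  finally have "(\<integral>\<^sup>+\<omega>. indicator (- {x}) (st 0 \<omega>) \<partial>P) = 0" .
  then have "AE \<omega> in P. indicator (- {x}) (st 0 \<omega>) = (0::ennreal)"
    by (subst (asm) nn_integral_0_iff_AE) measurable
  then show ?thesis
    by (rule eventually_mono) (auto simp: indicator_def split: if_splits)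
qed

text \<open>The bounds on \<open>w\<close> make all integrals finite, so the extended-valued Markov
  property descends to the reals. Events serve as test functions, as in the definition of
  conditional expectation.\<close>

lemma integral_Markov:
  assumes B[measurable]: "B \<in> sets (PiM {0..<Suc n} (\<lambda>_. XA))"
    and w[measurable]: "w \<in> borel_measurable (SX M)" and w01: "\<And>y. y \<in> states M \<Longrightarrow> 0 \<le> w y \<and> w y \<le> (1::real)"
  shows "(\<integral>\<omega>. indicator B (past (Suc n) \<omega>) * w (st (Suc n) \<omega>) \<partial>P) =
    (\<integral>\<omega>. indicator B (past (Suc n) \<omega>) * (\<integral>y. w y \<partial>trans_total M (\<omega> n)) \<partial>P)"
proof -
  note [measurable] = measurable_prob_algebraD[OF trans_total_measurable[OF mdp]]
  have st: "st n \<omega> \<in> states M" if "\<omega> \<in> space P" for n \<omega>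
    using measurable_space[OF measurable_st, of \<omega> n] that by (simp add: space_law space_SX)
  have "(\<integral>\<omega>. indicator B (past (Suc n) \<omega>) * w (st (Suc n) \<omega>) \<partial>P) =
    enn2real (\<integral>\<^sup>+\<omega>. ennreal (indicator B (past (Suc n) \<omega>) * w (st (Suc n) \<omega>)) \<partial>P)"
    using w01 st by (intro integral_eq_nn_integral AE_I2) auto
  also have "(\<integral>\<^sup>+\<omega>. ennreal (indicator B (past (Suc n) \<omega>) * w (st (Suc n) \<omega>)) \<partial>P) =
    (\<integral>\<^sup>+\<omega>. indicator B (past (Suc n) \<omega>) * ennreal (w (st (Suc n) \<omega>)) \<partial>P)"
    by (intro nn_integral_cong) (simp split: split_indicator)
  also have "\<dots> = (\<integral>\<^sup>+\<omega>. indicator B (past (Suc n) \<omega>) * (\<integral>\<^sup>+y. ennreal (w y) \<partial>trans_total M (\<omega> n)) \<partial>P)"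
    by (rule nn_integral_Markov) measurable
  also have "\<dots> = (\<integral>\<^sup>+\<omega>. ennreal (indicator B (past (Suc n) \<omega>) * (\<integral>y. w y \<partial>trans_total M (\<omega> n))) \<partial>P)"
  proof (intro nn_integral_cong)
    fix \<omega> assume "\<omega> \<in> space P"
    then have "\<omega> n \<in> space XA"
      by (auto simp: space_law space_PiM)
    then have "integrable (trans_total M (\<omega> n)) w" and space: "space (trans_total M (\<omega> n)) = states M"
      by (simp_all only: integrable_trans_total[OF _ w w01] space_trans_total)
    then have "(\<integral>\<^sup>+y. ennreal (w y) \<partial>trans_total M (\<omega> n)) = ennreal (\<integral>y. w y \<partial>trans_total M (\<omega> n))"
      using w01 space by (intro nn_integral_eq_integral AE_I2) auto
    then show "indicator B (past (Suc n) \<omega>) * (\<integral>\<^sup>+y. ennreal (w y) \<partial>trans_total M (\<omega> n)) =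
      ennreal (indicator B (past (Suc n) \<omega>) * (\<integral>y. w y \<partial>trans_total M (\<omega> n)))"
      by (simp split: split_indicator)
  qed
  also have "enn2real \<dots> = (\<integral>\<omega>. indicator B (past (Suc n) \<omega>) * (\<integral>y. w y \<partial>trans_total M (\<omega> n)) \<partial>P)"
  proof (rule integral_eq_nn_integral[symmetric])
    show "(\<lambda>\<omega>. indicator B (past (Suc n) \<omega>) * (\<integral>y. w y \<partial>trans_total M (\<omega> n))) \<in> borel_measurable P"
      by measurable
    show "AE \<omega> in P. 0 \<le> indicator B (past (Suc n) \<omega>) * (\<integral>y. w y \<partial>trans_total M (\<omega> n))"
    proof (intro AE_I2 mult_nonneg_nonneg)
      fix \<omega> assume "\<omega> \<in> space P"
      then have "\<omega> n \<in> space XA"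
        by (auto simp: space_law space_PiM)
      then show "0 \<le> (\<integral>y. w y \<partial>trans_total M (\<omega> n))"
        by (rule integral_trans_total_bounds[OF _ w w01])
    qed simp
  qed
  finally show ?thesis .
qed

end

section \<open>The stopped process\<close>

lemma less_Inf_enat_iff: "enat n < Inf {enat t |t. Q t} \<longleftrightarrow> (\<forall>t\<le>n. \<not> Q t)"
proof -
  have "enat n < Inf {enat t |t. Q t} \<longleftrightarrow> enat (Suc n) \<le> Inf {enat t |t. Q t}"
    by (simp add: Suc_ile_eq)
  also have "\<dots> \<longleftrightarrow> (\<forall>t\<le>n. \<not> Q t)"
    by (auto simp: le_Inf_iff not_less_eq_eq[symmetric])
  finally show ?thesis .
qed

text \<open>The event that the kill time exceeds \<open>n\<close>, expressed by finitely many
  coordinates; the equivalence is \<open>less_kill_time_iff\<close>.\<close>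

definition alive ::
    "('x::polish_space, 'a::polish_space) reach_mdp \<Rightarrow> nat \<Rightarrow> (nat \<Rightarrow> 'x \<times> 'a) \<Rightarrow> bool" where
  "alive M n \<omega> \<longleftrightarrow> (\<forall>s\<le>n. st s \<omega> \<in> live_states M)"

definition stopped_state ::
    "('x::polish_space, 'a::polish_space) reach_mdp \<Rightarrow> nat \<Rightarrow> (nat \<Rightarrow> 'x \<times> 'a) \<Rightarrow> 'x" where
  "stopped_state M n \<omega> = st (stopped M n \<omega>) \<omega>"

lemma stopped_0 [simp]: "stopped M 0 \<omega> = 0"
  unfolding stopped_def by (metis enat_0 i0_lb min_absorb1 the_enat.simps)

lemma stopped_state_0 [simp]: "stopped_state M 0 \<omega> = st 0 \<omega>"
  by (simp add: stopped_state_def)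

context reach_model
begin

text \<open>\<open>tau'\<close> counts only exits into \<open>states M - region M\<close>, so a path
  outside \<open>states M\<close> could fail to be live without being killed. Hence the assumption
  that recurs in this section.\<close>

lemma less_kill_time_iff:
  assumes "\<And>s. st s \<omega> \<in> states M"
  shows "enat n < kill_time M \<omega> \<longleftrightarrow> alive M n \<omega>"
  using assms unfolding kill_time_def tau_def tau'_def min_less_iff_conj less_Inf_enat_iff
  by (auto simp: alive_def live_states_def)

lemma stopped_Suc:
  assumes "\<And>s. st s \<omega> \<in> states M"
  shows "stopped M (Suc n) \<omega> = (if alive M n \<omega> then Suc n else stopped M n \<omega>)"
proof (cases "enat n < kill_time M \<omega>")
  case True
  then have "min (enat (Suc n)) (kill_time M \<omega>) = enat (Suc n)"
    by (simp add: Suc_ile_eq)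
  then show ?thesis
    using True less_kill_time_iff[OF assms] by (simp add: stopped_def)
next
  case False
  then have "kill_time M \<omega> \<le> enat n" "kill_time M \<omega> \<le> enat (Suc n)"
    by (auto simp: not_less intro: order_trans)
  then show ?thesis
    using False less_kill_time_iff[OF assms] by (simp add: stopped_def min_absorb2)
qed

lemma stopped_eq_if_alive:
  assumes "\<And>s. st s \<omega> \<in> states M" "alive M n \<omega>"
  shows "stopped M n \<omega> = n"
  using assms(2) stopped_Suc[OF assms(1)] by (cases n) (auto simp: alive_def)

lemma stopped_state_Suc:
  assumes "\<And>s. st s \<omega> \<in> states M"
  shows "stopped_state M (Suc n) \<omega> = (if alive M n \<omega> then st (Suc n) \<omega> else stopped_state M n \<omega>)"
  by (simp add: stopped_state_def stopped_Suc[OF assms])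

lemma stopped_state_if_alive:
  assumes "\<And>s. st s \<omega> \<in> states M" "alive M n \<omega>"
  shows "stopped_state M n \<omega> = st n \<omega>"
  by (simp add: stopped_state_def stopped_eq_if_alive[OF assms])

lemma stopped_state_live_iff:
  assumes "\<And>s. st s \<omega> \<in> states M"
  shows "stopped_state M n \<omega> \<in> live_states M \<longleftrightarrow> alive M n \<omega>"
proof (induction n)
  case 0
  then show ?case by (simp add: alive_def)
next
  case (Suc n)
  then show ?case
    by (auto simp: stopped_state_Suc[OF assms] alive_def le_Suc_eq)
qed

lemma live_before_stopped:
  assumes "\<And>s. st s \<omega> \<in> states M" "t < stopped M n \<omega>"
  shows "st t \<omega> \<in> live_states M"
  using assms(2) by (induction n) (auto simp: stopped_Suc[OF assms(1)] alive_def split: if_splits)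

lemma stopped_state_in_states:
  assumes "\<And>s. st s \<omega> \<in> states M"
  shows "stopped_state M n \<omega> \<in> states M"
  using assms by (simp add: stopped_state_def)

text \<open>Every state strictly before the stopped index is live, hence neither in the target nor
  outside the region. Reaching the target first is therefore a union of finite-horizon events of the
  stopped process.\<close>

lemma reach_iff:
  assumes "\<And>s. st s \<omega> \<in> states M"
  shows "tau M \<omega> < tau' M \<omega> \<and> tau M \<omega> < \<infinity> \<longleftrightarrow> (\<exists>n. stopped_state M n \<omega> \<in> target M)"
proof
  assume "tau M \<omega> < tau' M \<omega> \<and> tau M \<omega> < \<infinity>"
  then obtain k where k: "tau M \<omega> = enat k" "enat k < tau' M \<omega>"
    by (cases "tau M \<omega>") auto
  have "\<not> enat k < tau M \<omega>"
    by (simp add: k)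
  then have "\<exists>t. t \<le> k \<and> st t \<omega> \<in> target M"
    by (auto simp: tau_def less_Inf_enat_iff)
  \<comment> \<open>The first hit of the target, bounded by \<open>k\<close>; all earlier states are
    live because \<open>tau'\<close> exceeds \<open>k\<close>.\<close>
  then obtain n where n: "n \<le> k" "st n \<omega> \<in> target M" "\<And>t. t < n \<Longrightarrow> \<not> (t \<le> k \<and> st t \<omega> \<in> target M)"
    using exists_least_iff[of "\<lambda>t. t \<le> k \<and> st t \<omega> \<in> target M"] by blast
  have live: "st t \<omega> \<in> live_states M" if "t < n" for t
    using k(2) n(1) n(3)[OF that] that assms[of t] by (auto simp: tau'_def less_Inf_enat_iff live_states_def)
  have "stopped_state M n \<omega> = st n \<omega>"
    using live by (cases n) (auto simp: stopped_state_Suc[OF assms] alive_def)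
  then show "\<exists>n. stopped_state M n \<omega> \<in> target M"
    using n(2) by metis
next
  assume "\<exists>n. stopped_state M n \<omega> \<in> target M"
  then obtain n where n: "stopped_state M n \<omega> \<in> target M"
    by blast
  define k where "k = stopped M n \<omega>"
  have k: "st k \<omega> \<in> target M" "\<And>t. t < k \<Longrightarrow> st t \<omega> \<in> live_states M"
    using n live_before_stopped[OF assms] by (auto simp: k_def stopped_state_def)
  have "tau M \<omega> \<le> enat k"
    unfolding tau_def using k(1) by (intro Inf_lower) auto
  moreover have "enat k < tau' M \<omega>"
    using k target_subset by (auto simp: tau'_def less_Inf_enat_iff live_states_def le_less)
  ultimately have "tau M \<omega> < tau' M \<omega>"
    by (rule le_less_trans)
  then show "tau M \<omega> < tau' M \<omega> \<and> tau M \<omega> < \<infinity>"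
    using enat_ord_simps(6) less_le_trans by (cases "tau M \<omega>") auto
qed

text \<open>Stated for any \<open>N\<close> that sees the states up to time \<open>n\<close>, so
  that it serves both the path space and \<open>hist_filtration M n\<close>. The recursion
  \<open>stopped_state_Suc\<close> avoids the kill time, which depends on the whole path.\<close>

lemma measurable_stopped_state:
  assumes st: "\<And>s. s \<le> n \<Longrightarrow> st s \<in> N \<rightarrow>\<^sub>M SX M"
    and space: "space N \<subseteq> space (PiM UNIV (\<lambda>_. XA))"
  shows "stopped_state M n \<in> N \<rightarrow>\<^sub>M SX M"
  using st
proof (induction n)
  case 0
  then show ?case by (simp cong: measurable_cong)
next
  case (Suc n)
  have states: "st s \<omega> \<in> states M" if "\<omega> \<in> space N" for s \<omega>
  proof -
    have "\<omega> s \<in> space XA"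
      using subsetD[OF space that] by (auto simp: space_PiM)
    then show ?thesis
      by (auto simp: st_def space_pair_measure space_SX)
  qed
  have "{\<omega> \<in> space N. \<forall>s\<in>{..n}. st s \<omega> \<in> live_states M} \<in> sets N"
  proof (rule sets.sets_Collect_finite_All)
    fix s assume "s \<in> {..n}"
    then have "st s \<in> N \<rightarrow>\<^sub>M SX M"
      using Suc.prems by simp
    from measurable_sets[OF this sets_live_states]
    show "{\<omega> \<in> space N. st s \<omega> \<in> live_states M} \<in> sets N"
      by (simp add: vimage_def Int_def conj_commute)
  qed simp
  then have "{\<omega> \<in> space N. alive M n \<omega>} \<in> sets N"
    by (simp only: alive_def Ball_def atMost_iff)
  then have "(\<lambda>\<omega>. if alive M n \<omega> then st (Suc n) \<omega> else stopped_state M n \<omega>) \<in> N \<rightarrow>\<^sub>M SX M"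
    using Suc by (intro measurable_If) simp_all
  then show ?case
    by (rule measurable_cong[THEN iffD1, rotated]) (simp add: stopped_state_Suc[OF states])
qed

end

section \<open>Drift of functions of the stopped process\<close>

context reach_process
begin

lemma st_in_states: "\<omega> \<in> space P \<Longrightarrow> st s \<omega> \<in> states M"
  using measurable_space[OF measurable_st, of \<omega> s] by (simp add: space_law space_SX)

lemma coord_in_space: "\<omega> \<in> space P \<Longrightarrow> \<omega> n \<in> space XA"
  by (auto simp: space_law space_PiM)

lemma measurable_stopped_state_law[measurable]: "stopped_state M n \<in> PiM UNIV (\<lambda>_. XA) \<rightarrow>\<^sub>M SX M"
  by (rule measurable_stopped_state) simp_all

lemma sets_alive: "{\<eta> \<in> space (PiM {0..<Suc n} (\<lambda>_. XA)). alive M n \<eta>} \<in> sets (PiM {0..<Suc n} (\<lambda>_. XA))"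
proof -
  have "{\<eta> \<in> space (PiM {0..<Suc n} (\<lambda>_. XA)). \<forall>s\<in>{..n}. fst (\<eta> s) \<in> live_states M} \<in> sets (PiM {0..<Suc n} (\<lambda>_. XA))"
    by measurable
  then show ?thesis
    by (simp add: alive_def st_def)
qed

lemma alive_past: "alive M n (past (Suc n) \<omega>) \<longleftrightarrow> alive M n \<omega>"
  by (auto simp: alive_def st_def)

lemma past_in_space: "\<omega> \<in> space P \<Longrightarrow> past n \<omega> \<in> space (PiM {0..<n} (\<lambda>_. XA))"
  using measurable_space[OF measurable_past] by (simp add: space_law)

lemma measurable_alive[measurable]: "Measurable.pred (PiM UNIV (\<lambda>_. XA)) (alive M n)"
  using measurable_compose[OF measurable_past, of "alive M n" "Suc n" "count_space UNIV"] sets_alive[of n]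
  by (simp add: alive_past[abs_def] pred_def)

text \<open>Whether the path is alive is decided by the first \<open>Suc n\<close> coordinates, so
  the test event can be cut in two: on one part the next state follows the kernel, on the other the
  stopped process stands still.\<close>

lemma integral_stopped_state:
  assumes B[measurable]: "B \<in> sets (PiM {0..<Suc n} (\<lambda>_. XA))"
    and w[measurable]: "w \<in> borel_measurable (SX M)" and w01: "\<And>y. y \<in> states M \<Longrightarrow> 0 \<le> w y \<and> w y \<le> (1::real)"
  shows "(\<integral>\<omega>. indicator B (past (Suc n) \<omega>) * w (stopped_state M (Suc n) \<omega>) \<partial>P) =
    (\<integral>\<omega>. indicator B (past (Suc n) \<omega>) *
      (if alive M n \<omega> then \<integral>y. w y \<partial>trans_total M (\<omega> n) else w (stopped_state M n \<omega>)) \<partial>P)"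
proof -
  note [measurable] = measurable_prob_algebraD[OF trans_total_measurable[OF mdp]]
  define A where "A = {\<eta> \<in> space (PiM {0..<Suc n} (\<lambda>_. XA)). alive M n \<eta>}"
  have [measurable]: "A \<in> sets (PiM {0..<Suc n} (\<lambda>_. XA))"
    unfolding A_def by (rule sets_alive)
  have A: "past (Suc n) \<omega> \<in> A \<longleftrightarrow> alive M n \<omega>" if "\<omega> \<in> space P" for \<omega>
    using past_in_space[OF that] by (simp add: A_def alive_past)
  let ?b = "\<lambda>\<omega>. indicator B (past (Suc n) \<omega>) :: real"
  let ?r = "\<lambda>\<omega>. if alive M n \<omega> then 0 else ?b \<omega> * w (stopped_state M n \<omega>)"
  have r: "integrable P ?r"
    using w01 stopped_state_in_states[OF st_in_states]
    by (intro integrable_const_bound[of _ 1] AE_I2) (auto split: split_indicator)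
  have i1: "integrable P (\<lambda>\<omega>. indicator (A \<inter> B) (past (Suc n) \<omega>) * w (st (Suc n) \<omega>))"
    using w01 st_in_states by (intro integrable_const_bound[of _ 1] AE_I2) (auto split: split_indicator)
  have i2: "integrable P (\<lambda>\<omega>. indicator (A \<inter> B) (past (Suc n) \<omega>) * (\<integral>y. w y \<partial>trans_total M (\<omega> n)))"
    using integral_trans_total_bounds[OF coord_in_space w w01]
    by (intro integrable_const_bound[of _ 1] AE_I2) (auto split: split_indicator)
  have "(\<integral>\<omega>. ?b \<omega> * w (stopped_state M (Suc n) \<omega>) \<partial>P) =
    (\<integral>\<omega>. indicator (A \<inter> B) (past (Suc n) \<omega>) * w (st (Suc n) \<omega>) + ?r \<omega> \<partial>P)"
    by (intro Bochner_Integration.integral_cong refl)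
      (auto simp: stopped_state_Suc[OF st_in_states] A split: split_indicator)
  also have "\<dots> = (\<integral>\<omega>. indicator (A \<inter> B) (past (Suc n) \<omega>) * (\<integral>y. w y \<partial>trans_total M (\<omega> n)) + ?r \<omega> \<partial>P)"
    using integral_Markov[OF _ w w01, of "A \<inter> B" n]
    by (simp add: Bochner_Integration.integral_add[OF i1 r] Bochner_Integration.integral_add[OF i2 r])
  also have "\<dots> = (\<integral>\<omega>. ?b \<omega> *
      (if alive M n \<omega> then \<integral>y. w y \<partial>trans_total M (\<omega> n) else w (stopped_state M n \<omega>)) \<partial>P)"
    by (intro Bochner_Integration.integral_cong refl) (auto simp: A split: split_indicator)
  finally show ?thesis .
qed

lemma integrable_stopped_state:
  assumes w[measurable]: "w \<in> borel_measurable (SX M)" and w01: "\<And>y. y \<in> states M \<Longrightarrow> 0 \<le> w y \<and> w y \<le> (1::real)"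
  shows "integrable P (\<lambda>\<omega>. w (stopped_state M n \<omega>))"
  using w01 stopped_state_in_states[OF st_in_states] by (intro integrable_const_bound[of _ 1] AE_I2) auto

lemma integral_stopped_state_0:
  "w \<in> borel_measurable (SX M) \<Longrightarrow> (\<integral>\<omega>. w (stopped_state M 0 \<omega>) \<partial>P) = (w x :: real)"
proof -
  assume [measurable]: "w \<in> borel_measurable (SX M)"
  have "(\<integral>\<omega>. w (stopped_state M 0 \<omega>) \<partial>P) = (\<integral>\<omega>. w x \<partial>P)"
    using AE_start by (intro integral_cong_AE) auto
  then show ?thesis
    by (simp add: prob_space)
qed

text \<open>The expected one-step decrease of \<open>w\<close> along the stopped process, given the
  path up to the action at time \<open>n\<close>; it is zero after killing. For
  \<open>w = Vstar M\<close> this is D_n.\<close>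

definition loss :: "('x \<Rightarrow> real) \<Rightarrow> nat \<Rightarrow> (nat \<Rightarrow> 'x \<times> 'a) \<Rightarrow> real" where
  "loss w n \<omega> = (if alive M n \<omega> then w (st n \<omega>) - (\<integral>y. w y \<partial>trans_total M (\<omega> n)) else 0)"

lemma measurable_loss[measurable]:
  assumes [measurable]: "w \<in> borel_measurable (SX M)"
  shows "loss w n \<in> borel_measurable (PiM UNIV (\<lambda>_. XA))"
proof -
  note [measurable] = measurable_prob_algebraD[OF trans_total_measurable[OF mdp]]
  show ?thesis
    unfolding loss_def[abs_def] by measurable
qed

lemma integrable_loss:
  assumes w[measurable]: "w \<in> borel_measurable (SX M)" and w01: "\<And>y. y \<in> states M \<Longrightarrow> 0 \<le> w y \<and> w y \<le> (1::real)"
  shows "integrable P (loss w n)"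
proof (rule integrable_const_bound[of _ 1])
  show "AE \<omega> in P. norm (loss w n \<omega>) \<le> 1"
  proof (rule AE_I2)
    fix \<omega> assume \<omega>: "\<omega> \<in> space P"
    show "norm (loss w n \<omega>) \<le> 1"
      using w01[OF st_in_states[OF \<omega>, of n]] integral_trans_total_bounds[OF coord_in_space[OF \<omega>, of n] w w01]
      by (auto simp: loss_def)
  qed
qed measurable

text \<open>The compensator identity in weak form. Test events may involve the action at time
  \<open>n\<close>, so it holds for a finer sigma-algebra than that of
  \<open>hist n\<close>.\<close>

lemma integral_stopped_state_loss:
  assumes B[measurable]: "B \<in> sets (PiM {0..<Suc n} (\<lambda>_. XA))"
    and w[measurable]: "w \<in> borel_measurable (SX M)" and w01: "\<And>y. y \<in> states M \<Longrightarrow> 0 \<le> w y \<and> w y \<le> (1::real)"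
  shows "(\<integral>\<omega>. indicator B (past (Suc n) \<omega>) * w (stopped_state M (Suc n) \<omega>) \<partial>P) =
    (\<integral>\<omega>. indicator B (past (Suc n) \<omega>) * w (stopped_state M n \<omega>) \<partial>P) -
    (\<integral>\<omega>. indicator B (past (Suc n) \<omega>) * loss w n \<omega> \<partial>P)"
proof -
  let ?b = "\<lambda>\<omega>. indicator B (past (Suc n) \<omega>) :: real"
  have "integrable P (\<lambda>\<omega>. ?b \<omega> * w (stopped_state M n \<omega>))"
    by (rule Bochner_Integration.integrable_bound[OF integrable_stopped_state[OF w w01, of n]])
      (auto split: split_indicator)
  moreover have "integrable P (\<lambda>\<omega>. ?b \<omega> * loss w n \<omega>)"
    by (rule Bochner_Integration.integrable_bound[OF integrable_loss[OF w w01, of n]])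
      (auto split: split_indicator)
  ultimately have int: "integrable P (\<lambda>\<omega>. ?b \<omega> * w (stopped_state M n \<omega>))" "integrable P (\<lambda>\<omega>. ?b \<omega> * loss w n \<omega>)" .
  note integral_diff = Bochner_Integration.integral_diff[OF int]
  have "(\<integral>\<omega>. ?b \<omega> * (if alive M n \<omega> then \<integral>y. w y \<partial>trans_total M (\<omega> n) else w (stopped_state M n \<omega>)) \<partial>P) =
    (\<integral>\<omega>. ?b \<omega> * w (stopped_state M n \<omega>) - ?b \<omega> * loss w n \<omega> \<partial>P)"
    by (intro Bochner_Integration.integral_cong refl)
      (auto simp: loss_def stopped_state_if_alive[OF st_in_states] split: split_indicator)
  then show ?thesis
    using integral_stopped_state[OF B w w01] by (simp only: integral_diff)
qed

lemma integral_stopped_state_Suc: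
  assumes w: "w \<in> borel_measurable (SX M)" and w01: "\<And>y. y \<in> states M \<Longrightarrow> 0 \<le> w y \<and> w y \<le> (1::real)"
  shows "(\<integral>\<omega>. w (stopped_state M (Suc n) \<omega>) \<partial>P) =
    (\<integral>\<omega>. w (stopped_state M n \<omega>) \<partial>P) - (\<integral>\<omega>. loss w n \<omega> \<partial>P)"
proof -
  let ?S = "space (PiM {0..<Suc n} (\<lambda>_. XA))"
  have "(\<integral>\<omega>. f \<omega> \<partial>P) = (\<integral>\<omega>. indicator ?S (past (Suc n) \<omega>) * f \<omega> \<partial>P)" for f :: "_ \<Rightarrow> real"
    by (intro Bochner_Integration.integral_cong refl) (simp add: past_in_space)
  then show ?thesis
    using integral_stopped_state_loss[OF sets.top w w01, of n] by simp
qed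

lemma AE_live_pairs: "AE \<omega> in P. \<forall>n. alive M n \<omega> \<longrightarrow> \<omega> n \<in> live_pairs M"
  using AE_feasible AE_space
proof eventually_elim
  case (elim \<omega>)
  show ?case
  proof (intro allI impI)
    fix n assume "alive M n \<omega>"
    then have "st n \<omega> \<in> live_states M"
      by (simp add: alive_def)
    then show "\<omega> n \<in> live_pairs M"
      using elim(1)[rule_format, of n]
      by (auto simp: live_pairs_def feasible_pairs_def st_def)
  qed
qed

text \<open>The inequality is assumed on live pairs only; almost every path visits no others while
  it is alive.\<close>

lemma loss_nonneg:
  assumes super: "\<And>y a. (y, a) \<in> live_pairs M \<Longrightarrow> (\<integral>z. w z \<partial>trans_total M (y, a)) \<le> w y"
  shows "AE \<omega> in P. 0 \<le> loss w n \<omega>"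
  using AE_live_pairs
proof eventually_elim
  case (elim \<omega>)
  then show ?case
    using super[of "fst (\<omega> n)" "snd (\<omega> n)"] by (auto simp: loss_def st_def)
qed

lemma integral_stopped_state_le:
  assumes w: "w \<in> borel_measurable (SX M)" and w01: "\<And>y. y \<in> states M \<Longrightarrow> 0 \<le> w y \<and> w y \<le> (1::real)"
    and super: "\<And>y a. (y, a) \<in> live_pairs M \<Longrightarrow> (\<integral>z. w z \<partial>trans_total M (y, a)) \<le> w y"
  shows "(\<integral>\<omega>. w (stopped_state M n \<omega>) \<partial>P) \<le> w x"
proof (induction n)
  case 0
  then show ?case
    by (simp only: integral_stopped_state_0[OF w])
next
  case (Suc n)
  then show ?case
    using integral_nonneg_AE[OF loss_nonneg[OF super], of n] integral_stopped_state_Suc[OF w w01, of n] by simp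
qed

section \<open>Reaching probabilities and excessive majorants\<close>

lemma value_of_eq: "value_of M \<pi> x = measure P (\<Union>n. {\<omega> \<in> space P. stopped_state M n \<omega> \<in> target M})"
  unfolding value_of_def using reach_iff[OF st_in_states] by (intro arg_cong[where f="measure P"]) blast

lemma sets_reach[measurable]: "{\<omega> \<in> space P. stopped_state M n \<omega> \<in> target M} \<in> sets P"
  by measurable

lemma measure_reach_eq:
  "measure P {\<omega> \<in> space P. stopped_state M n \<omega> \<in> target M} =
    (\<integral>\<omega>. indicator (target M) (stopped_state M n \<omega>) \<partial>P)"
proof -
  have "(\<integral>\<omega>. (indicator (target M) (stopped_state M n \<omega>) :: real) \<partial>P) =
    (\<integral>\<omega>. indicator {\<omega> \<in> space P. stopped_state M n \<omega> \<in> target M} \<omega> \<partial>P)"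
    by (intro Bochner_Integration.integral_cong refl) (simp split: split_indicator)
  then show ?thesis
    by simp
qed

lemma integral_reach_le_value_of:
  "(\<integral>\<omega>. indicator (target M) (stopped_state M n \<omega>) \<partial>P) \<le> value_of M \<pi> x"
  unfolding measure_reach_eq[symmetric] value_of_eq by (intro finite_measure_mono) auto

text \<open>\<open>w\<close> dominates the indicator of the target, so the probability of having
  reached it by time \<open>n\<close> is at most the mean of \<open>w\<close> at the stopped state,
  hence at most \<open>w x\<close>; then \<open>n\<close> tends to infinity.\<close>

lemma value_of_le:
  assumes w: "w \<in> borel_measurable (SX M)" and w01: "\<And>y. y \<in> states M \<Longrightarrow> 0 \<le> w y \<and> w y \<le> (1::real)"
    and super: "\<And>y a. (y, a) \<in> live_pairs M \<Longrightarrow> (\<integral>z. w z \<partial>trans_total M (y, a)) \<le> w y"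
    and target: "\<And>y. y \<in> target M \<Longrightarrow> w y = 1"
  shows "value_of M \<pi> x \<le> w x"
proof -
  let ?E = "\<lambda>n. {\<omega> \<in> space P. stopped_state M n \<omega> \<in> target M}"
  \<comment> \<open>The target is absorbing for the stopped process, so these events increase to the
    reaching event.\<close>
  have "?E n \<subseteq> ?E (Suc n)" for n
  proof safe
    fix \<omega> assume \<omega>: "\<omega> \<in> space P" and target: "stopped_state M n \<omega> \<in> target M"
    then have "\<not> alive M n \<omega>"
      using stopped_state_live_iff[OF st_in_states[OF \<omega>], of n] by (simp add: live_states_def)
    then show "stopped_state M (Suc n) \<omega> \<in> target M"
      using target by (simp add: stopped_state_Suc[OF st_in_states[OF \<omega>]])
  qed
  then have "(\<lambda>n. measure P (?E n)) \<longlonglongrightarrow> value_of M \<pi> x"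
    unfolding value_of_eq by (intro finite_Lim_measure_incseq incseq_SucI) auto
  moreover have "measure P (?E n) \<le> w x" for n
  proof -
    have "measure P (?E n) \<le> (\<integral>\<omega>. w (stopped_state M n \<omega>) \<partial>P)"
      unfolding measure_reach_eq
      using w01 target stopped_state_in_states[OF st_in_states]
      by (intro integral_mono integrable_stopped_state w)
        (auto split: split_indicator intro!: integrable_stopped_state w)
    also have "\<dots> \<le> w x"
      by (rule integral_stopped_state_le[OF w w01 super])
    finally show ?thesis .
  qed
  ultimately show ?thesis
    using LIMSEQ_le_const2 by blast
qed

end

section \<open>The value function\<close>

locale reach_feller = reach_model M
  for M :: "('x::polish_space, 'a::polish_space) reach_mdp" +
  assumes compact_feas: "\<And>y. y \<in> live_states M \<Longrightarrow> compact (feas M y)"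
    and uhc: "upper_hemicontinuous_on (live_states M) (actions M) (feas M)"
    and feller: "strongly_Feller M"
begin

lemma live_states_subset: "live_states M \<subseteq> states M"
  using region_subset by (auto simp: live_states_def)

lemma feas_props:
  assumes "y \<in> states M"
  shows "feas M y \<noteq> {}" "feas M y \<in> sets (SA M)" "feas M y \<subseteq> actions M"
  using mdp assms sets.sets_into_space[of "feas M y" "SA M"] by (auto simp: is_reach_mdp_def space_SA)

lemma live_pairs_space: "(y, a) \<in> live_pairs M \<Longrightarrow> (y, a) \<in> space XA"
  using sets.sets_into_space[OF sets_live_pairs[OF mdp]] by auto

lemma trans_total_live: "p \<in> live_pairs M \<Longrightarrow> trans_total M p = trans M p"
  using live_pairs_eq[OF mdp] by (simp add: trans_total_def)

lemma restrict_SX_live: "restrict_space (SX M) (live_states M) = restrict_space borel (live_states M)"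
proof -
  have "states M \<in> sets borel"
    using mdp by (simp add: is_reach_mdp_def)
  moreover from this have "live_states M \<in> sets borel"
    using sets_live_states by (simp add: SX_def sets_restrict_space_iff)
  ultimately show ?thesis
    unfolding SX_def using live_states_subset by (subst restrict_restrict_space) (simp_all add: Int_absorb1)
qed

text \<open>The boundary values are 1 on the target and 0 outside the region. Fixing them here makes
  integrals over \<open>region M\<close> and over all states coincide for every iterate.\<close>

definition bellman :: "('x \<Rightarrow> real) \<Rightarrow> 'x \<Rightarrow> real" where
  "bellman w y = (if y \<in> live_states M then SUP a\<in>feas M y. \<integral>z. w z \<partial>trans_total M (y, a)
    else indicator (target M) y)"

text \<open>Values in the unit interval make \<open>w\<close> integrable for every transition law
  and along the stopped process, and supply the dominating constant 1.\<close>

definition admissible :: "('x \<Rightarrow> real) \<Rightarrow> bool" where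
  "admissible w \<longleftrightarrow> w \<in> borel_measurable (SX M) \<and> (\<forall>y\<in>states M. 0 \<le> w y \<and> w y \<le> 1)"

lemma admissibleD:
  assumes "admissible w"
  shows "w \<in> borel_measurable (SX M)" "y \<in> states M \<Longrightarrow> 0 \<le> w y \<and> w y \<le> 1"
  using assms by (auto simp: admissible_def)

text \<open>The strong Feller property makes the integral continuous on the graph of the feasible
  sets although \<open>w\<close> is only Borel, so the maximum lemma applies on the live
  states.\<close>

lemma bellman_attained:
  assumes w: "admissible w"
  obtains s where "s \<in> restrict_space borel (live_states M) \<rightarrow>\<^sub>M borel"
    "\<And>y. y \<in> live_states M \<Longrightarrow> s y \<in> feas M y"
    "\<And>y. y \<in> live_states M \<Longrightarrow> (\<integral>z. w z \<partial>trans_total M (y, s y)) = bellman w y"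
    "bellman w \<in> borel_measurable (SX M)"
proof -
  have graph: "{(y, a). y \<in> live_states M \<and> a \<in> feas M y} = live_pairs M"
    by (simp add: live_pairs_def)
  have "w \<in> borel_measurable (SX M)" "bounded (w ` states M)"
    using w by (auto simp: admissible_def bounded_iff intro!: exI[of _ 1])
  then have "continuous_on (live_pairs M) (\<lambda>p. \<integral>z. w z \<partial>trans M p)"
    using feller by (simp add: strongly_Feller_def)
  then have cont: "continuous_on {(y, a). y \<in> live_states M \<and> a \<in> feas M y} (\<lambda>p. \<integral>z. w z \<partial>trans_total M p)"
    unfolding graph by (rule continuous_on_cong[THEN iffD1, rotated 2]) (simp_all add: trans_total_live)
  have ne: "feas M y \<noteq> {}" "feas M y \<subseteq> actions M" if "y \<in> live_states M" for y
    using feas_props[of y] that live_states_subset by auto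
  obtain s where s: "s \<in> restrict_space borel (live_states M) \<rightarrow>\<^sub>M borel"
    "\<And>y. y \<in> live_states M \<Longrightarrow> s y \<in> feas M y"
    "\<And>y. y \<in> live_states M \<Longrightarrow> (\<integral>z. w z \<partial>trans_total M (y, s y)) =
      (SUP a\<in>feas M y. \<integral>z. w z \<partial>trans_total M (y, a))"
    "(\<lambda>y. SUP a\<in>feas M y. \<integral>z. w z \<partial>trans_total M (y, a)) \<in> borel_measurable (restrict_space borel (live_states M))"
    by (rule upper_hemicontinuous_maximum[OF uhc compact_feas ne cont]) auto
  have "bellman w \<in> borel_measurable (SX M)"
    unfolding bellman_def[abs_def]
  proof (subst measurable_If_restrict_space_iff)
    show "{y \<in> space (SX M). y \<in> live_states M} \<in> sets (SX M)"
      by measurable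
    show "(\<lambda>y. SUP a\<in>feas M y. \<integral>z. w z \<partial>trans_total M (y, a)) \<in> borel_measurable (restrict_space (SX M) {y. y \<in> live_states M}) \<and>
      (indicator (target M) :: _ \<Rightarrow> real) \<in> borel_measurable (restrict_space (SX M) {y. y \<notin> live_states M})"
      using s(4) by (auto simp: restrict_SX_live intro!: measurable_restrict_space1)
  qed
  then show thesis
    using s by (intro that[of s]) (simp_all add: bellman_def)
qed

lemma bellman_upper:
  assumes w: "admissible w" and p: "(y, a) \<in> live_pairs M"
  shows "(\<integral>z. w z \<partial>trans_total M (y, a)) \<le> bellman w y"
proof -
  have y: "y \<in> live_states M" "a \<in> feas M y"
    using p by (auto simp: live_pairs_def)
  have "bdd_above ((\<lambda>a. \<integral>z. w z \<partial>trans_total M (y, a)) ` feas M y)"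
  proof (rule bdd_aboveI2)
    fix b assume "b \<in> feas M y"
    then have "(y, b) \<in> space XA"
      using y by (intro live_pairs_space) (simp add: live_pairs_def)
    then show "(\<integral>z. w z \<partial>trans_total M (y, b)) \<le> 1"
      using integral_trans_total_bounds admissibleD[OF w] by blast
  qed
  from cSUP_upper[OF y(2) this] show ?thesis
    using y by (simp add: bellman_def)
qed

lemma admissible_bellman:
  assumes w: "admissible w"
  shows "admissible (bellman w)"
proof -
  obtain s where s: "\<And>y. y \<in> live_states M \<Longrightarrow> s y \<in> feas M y"
    "\<And>y. y \<in> live_states M \<Longrightarrow> (\<integral>z. w z \<partial>trans_total M (y, s y)) = bellman w y"
    "bellman w \<in> borel_measurable (SX M)"
    using bellman_attained[OF w] by metis
  have "0 \<le> bellman w y \<and> bellman w y \<le> 1" for y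
  proof (cases "y \<in> live_states M")
    case True
    then have "(y, s y) \<in> space XA"
      using s(1) by (intro live_pairs_space) (simp add: live_pairs_def)
    then show ?thesis
      using s(2)[OF True] integral_trans_total_bounds admissibleD[OF w] by metis
  qed (simp add: bellman_def)
  then show ?thesis
    using s(3) by (simp add: admissible_def)
qed

text \<open>A finite-horizon value: the largest probability of reaching the target within
  \<open>n\<close> steps before leaving the region.\<close>

definition viter :: "nat \<Rightarrow> 'x \<Rightarrow> real" where
  "viter n = (bellman ^^ n) (indicator (target M))"

lemma viter_0: "viter 0 = indicator (target M)"
  and viter_Suc: "viter (Suc n) = bellman (viter n)"
  by (simp_all add: viter_def)

lemma admissible_viter: "admissible (viter n)"
  by (induction n) (simp_all add: viter_0 viter_Suc admissible_bellman, simp add: admissible_def)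

lemma viter_not_live: "y \<notin> live_states M \<Longrightarrow> viter n y = indicator (target M) y"
  by (cases n) (simp_all add: viter_0 viter_Suc bellman_def)

text \<open>A maximiser for \<open>v\<close> is also a candidate in the supremum for
  \<open>w\<close>.\<close>

lemma bellman_mono:
  assumes v: "admissible v" and w: "admissible w" and le: "\<And>y. y \<in> states M \<Longrightarrow> v y \<le> w y"
  shows "bellman v y \<le> bellman w y"
proof (cases "y \<in> live_states M")
  case True
  obtain s where s: "\<And>y. y \<in> live_states M \<Longrightarrow> s y \<in> feas M y"
    "\<And>y. y \<in> live_states M \<Longrightarrow> (\<integral>z. v z \<partial>trans_total M (y, s y)) = bellman v y"
    using bellman_attained[OF v] by metis
  have p: "(y, s y) \<in> live_pairs M"
    using s(1) True by (simp add: live_pairs_def)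
  note sp = live_pairs_space[OF p]
  have "bellman v y = (\<integral>z. v z \<partial>trans_total M (y, s y))"
    using s(2) True by simp
  also have "\<dots> \<le> (\<integral>z. w z \<partial>trans_total M (y, s y))"
    using le space_trans_total[OF sp]
    by (intro integral_mono integrable_trans_total[OF sp] admissibleD[OF v] admissibleD[OF w]) auto
  also have "\<dots> \<le> bellman w y"
    by (rule bellman_upper[OF w p])
  finally show ?thesis .
qed (simp add: bellman_def)

lemma viter_mono_Suc: "y \<in> states M \<Longrightarrow> viter n y \<le> viter (Suc n) y"
proof (induction n arbitrary: y)
  case 0
  then show ?case
    using admissibleD(2)[OF admissible_viter, of y "Suc 0"] viter_not_live[of y "Suc 0"]
    by (cases "y \<in> live_states M") (auto simp: viter_0 live_states_def split: split_indicator)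
next
  case (Suc n)
  show ?case
    unfolding viter_Suc[of "Suc n"] viter_Suc[of n]
    by (rule bellman_mono) (use admissible_viter[of "Suc n"] Suc.IH in \<open>simp_all add: admissible_viter viter_Suc\<close>)
qed

section \<open>Limit of value iteration\<close>

definition vlim :: "'x \<Rightarrow> real" where
  "vlim y = (SUP n. viter n y)"

lemma viter_bdd: "y \<in> states M \<Longrightarrow> bdd_above (range (\<lambda>n. viter n y))"
  using admissibleD(2)[OF admissible_viter] by (intro bdd_aboveI2[of _ _ 1]) auto

lemma viter_le_vlim: "y \<in> states M \<Longrightarrow> viter n y \<le> vlim y"
  unfolding vlim_def by (rule cSUP_upper[OF _ viter_bdd]) simp_all

lemma viter_tendsto: "y \<in> states M \<Longrightarrow> (\<lambda>n. viter n y) \<longlonglongrightarrow> vlim y"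
  unfolding vlim_def by (intro LIMSEQ_incseq_SUP viter_bdd incseq_SucI viter_mono_Suc)

lemma admissible_vlim: "admissible vlim"
  unfolding admissible_def
proof (intro conjI ballI)
  show "vlim \<in> borel_measurable (SX M)"
    by (rule borel_measurable_LIMSEQ_real[OF viter_tendsto admissibleD(1)[OF admissible_viter]])
      (simp add: space_SX)
  fix y assume y: "y \<in> states M"
  show "0 \<le> vlim y"
    using viter_le_vlim[OF y, of 0] admissibleD(2)[OF admissible_viter y, of 0] by simp
  show "vlim y \<le> 1"
    unfolding vlim_def using admissibleD(2)[OF admissible_viter y] by (intro cSUP_least) auto
qed

lemma vlim_not_live: "y \<notin> live_states M \<Longrightarrow> vlim y = indicator (target M) y"
  by (simp add: vlim_def viter_not_live)

text \<open>Each integral is bounded by \<open>viter (Suc n) y\<close>, hence by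
  \<open>vlim y\<close>, before \<open>n\<close> tends to infinity; so no limit is exchanged with
  the supremum over actions.\<close>

lemma vlim_excessive:
  assumes p: "(y, a) \<in> live_pairs M"
  shows "(\<integral>z. vlim z \<partial>trans_total M (y, a)) \<le> vlim y"
proof -
  note sp = live_pairs_space[OF p]
  interpret prob_space "trans_total M (y, a)"
    by (rule prob_space_trans_total[OF sp])
  note sets = sets_trans_total[OF sp] and space = space_trans_total[OF sp]
  have "(\<lambda>n. \<integral>z. viter n z \<partial>trans_total M (y, a)) \<longlonglongrightarrow> (\<integral>z. vlim z \<partial>trans_total M (y, a))"
  proof (rule integral_dominated_convergence[where w="\<lambda>_. 1"])
    show "vlim \<in> borel_measurable (trans_total M (y, a))" "viter n \<in> borel_measurable (trans_total M (y, a))" for n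
      using admissibleD(1)[OF admissible_vlim] admissibleD(1)[OF admissible_viter] sets
      by (simp_all cong: measurable_cong_sets)
    show "AE z in trans_total M (y, a). (\<lambda>n. viter n z) \<longlonglongrightarrow> vlim z"
      using viter_tendsto space by (intro AE_I2) simp
    show "AE z in trans_total M (y, a). norm (viter n z) \<le> 1" for n
      using admissibleD(2)[OF admissible_viter] space by (intro AE_I2) simp
  qed simp
  moreover have "(\<integral>z. viter n z \<partial>trans_total M (y, a)) \<le> vlim y" for n
  proof -
    have "y \<in> states M"
      using p live_states_subset by (auto simp: live_pairs_def)
    then show ?thesis
      using bellman_upper[OF admissible_viter p, of n] viter_le_vlim[of y "Suc n"] by (simp add: viter_Suc)
  qed
  ultimately show ?thesis
    using LIMSEQ_le_const2 by blast
qed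

section \<open>The limit is the optimal value\<close>

lemma value_of_le_vlim:
  assumes "\<pi> \<in> policies M" "x \<in> states M"
  shows "value_of M \<pi> x \<le> vlim x"
proof -
  interpret reach_process M \<pi> x
    by unfold_locales (use assms in auto)
  show ?thesis
    by (rule value_of_le[OF admissibleD[OF admissible_vlim] vlim_excessive])
      (simp_all add: vlim_not_live live_states_def)
qed

text \<open>Policies prescribe actions only on live histories, which is why selectors on live states
  define one. The selectors are Borel maps into the ambient type; feasibility makes them maps into
  \<open>SA M\<close>.\<close>

lemma deterministic_policy:
  assumes s: "\<And>t. s t \<in> restrict_space borel (live_states M) \<rightarrow>\<^sub>M borel"
    and feas: "\<And>t y. y \<in> live_states M \<Longrightarrow> s t y \<in> feas M y"
  shows "(\<lambda>t h. return (SA M) (s t (snd h))) \<in> policies M"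
  unfolding policies_def
proof (intro CollectI allI conjI ballI)
  fix t
  let ?H = "restrict_space (hist_space M t) (live_hists M t)"
  have live: "snd h \<in> live_states M" if "h \<in> live_hists M t" for h
    using that by (simp add: live_hists_def)
  have "snd \<in> ?H \<rightarrow>\<^sub>M SX M"
    unfolding hist_space_def by (intro measurable_restrict_space1) simp
  then have "snd \<in> ?H \<rightarrow>\<^sub>M restrict_space (SX M) (live_states M)"
    using live by (intro measurable_restrict_space2) (auto simp: space_restrict_space)
  then have "snd \<in> ?H \<rightarrow>\<^sub>M restrict_space borel (live_states M)"
    by (simp only: restrict_SX_live)
  from measurable_compose[OF this s]
  have "(\<lambda>h. s t (snd h)) \<in> ?H \<rightarrow>\<^sub>M SA M"
    unfolding SA_def using feas live feas_props(3) live_states_subset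
    by (intro measurable_restrict_space2) (auto simp: space_restrict_space, blast)
  then show "(\<lambda>h. return (SA M) (s t (snd h))) \<in> ?H \<rightarrow>\<^sub>M prob_algebra (SA M)"
    by (rule measurable_compose) simp
  fix h assume "h \<in> live_hists M t"
  then have "snd h \<in> live_states M"
    by (rule live)
  then show "measure (return (SA M) (s t (snd h))) (feas M (snd h)) = 1"
    using feas feas_props(2) live_states_subset by (simp add: measure_return subset_iff)
qed

text \<open>At time \<open>t\<close> there are \<open>N - t\<close> steps left, so a maximiser for
  \<open>viter (N - Suc t)\<close> is played. The mean of \<open>viter (N - n)\<close> at the
  stopped state then stays constant, from \<open>viter N x\<close> at \<open>n = 0\<close> to a
  reaching probability at \<open>n = N\<close>.\<close>

lemma viter_le_value:
  assumes x: "x \<in> states M"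
  shows "\<exists>\<pi>\<in>policies M. viter N x \<le> value_of M \<pi> x"
proof -
  have "\<forall>k. \<exists>s. s \<in> restrict_space borel (live_states M) \<rightarrow>\<^sub>M borel \<and>
    (\<forall>y\<in>live_states M. s y \<in> feas M y \<and> (\<integral>z. viter k z \<partial>trans_total M (y, s y)) = viter (Suc k) y)"
    using bellman_attained[OF admissible_viter] unfolding viter_Suc by metis
  then obtain s where s: "\<And>k. s k \<in> restrict_space borel (live_states M) \<rightarrow>\<^sub>M borel"
    "\<And>k y. y \<in> live_states M \<Longrightarrow> s k y \<in> feas M y"
    "\<And>k y. y \<in> live_states M \<Longrightarrow> (\<integral>z. viter k z \<partial>trans_total M (y, s k y)) = viter (Suc k) y"
    by metis
  \<comment> \<open>Truncated subtraction repeats the selector \<open>s 0\<close> once the horizon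
    is used up; actions from time \<open>N\<close> on do not affect the state stopped at time
    \<open>N\<close>.\<close>
  define \<pi> where "\<pi> t h = return (SA M) (s (N - Suc t) (snd h))" for t and h :: "('x, 'a) history"
  have \<pi>: "\<pi> \<in> policies M"
    unfolding \<pi>_def[abs_def] by (rule deterministic_policy) (use s in auto)
  interpret reach_process M \<pi> x
    by unfold_locales (use \<pi> x in auto)
  note [measurable] = measurable_prob_algebraD[OF trans_total_measurable[OF mdp]]
  have act: "AE \<omega> in P. hist n \<omega> \<in> live_hists M n \<longrightarrow>
      (\<integral>z. viter (N - Suc n) z \<partial>trans_total M (\<omega> n)) = viter (Suc (N - Suc n)) (st n \<omega>)" for n
  proof -
    let ?k = "N - Suc n"
    note [measurable] = admissibleD(1)[OF admissible_viter] sets_live_hists[OF mdp, of n]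
    have [measurable]: "snd \<in> hist_space M n \<rightarrow>\<^sub>M SX M"
      by (simp add: hist_space_def)
    let ?R = "{p \<in> space (hist_space M n \<Otimes>\<^sub>M SA M). fst p \<in> live_hists M n \<longrightarrow>
      (\<integral>z. viter ?k z \<partial>trans_total M (snd (fst p), snd p)) = viter (Suc ?k) (snd (fst p))}"
    have R: "?R \<in> sets (hist_space M n \<Otimes>\<^sub>M SA M)"
      by measurable
    have "AE \<omega> in P. (hist n \<omega>, ac n \<omega>) \<in> ?R"
    proof (rule AE_action[OF R])
      fix h assume h: "h \<in> space (hist_space M n)"
      show "AE a in act_kernel M \<pi> n h. (h, a) \<in> ?R"
      proof (cases "h \<in> live_hists M n")
        case True
        then have y: "snd h \<in> live_states M"
          by (simp add: live_hists_def)
        then have a: "s ?k (snd h) \<in> space (SA M)"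
          using s(2)[OF y] feas_props(3) live_states_subset by (auto simp: space_SA)
        have "Measurable.pred (SA M) (\<lambda>a. (h, a) \<in> ?R)"
          using R h by measurable
        then have "AE a in return (SA M) (s ?k (snd h)). (h, a) \<in> ?R"
          using s(3)[OF y] a h by (subst AE_return) (auto simp: space_pair_measure)
        moreover have "act_kernel M \<pi> n h = return (SA M) (s ?k (snd h))"
          using True by (simp add: act_kernel_def \<pi>_def)
        ultimately show ?thesis
          by (rule ssubst[rotated])
      next
        case False
        have "space (act_kernel M \<pi> n h) = space (SA M)"
          using sets_eq_imp_space_eq[OF prob_space_act_kernel(2)[OF h]] .
        then show ?thesis
          using False h by (intro AE_I2) (simp add: space_pair_measure)
      qed
    qed
    then show ?thesis
      by eventually_elim (simp add: hist_def st_def ac_def)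
  qed
  have "(\<integral>\<omega>. viter (N - n) (stopped_state M n \<omega>) \<partial>P) = viter N x" if "n \<le> N" for n
    using that
  proof (induction n)
    case 0
    then show ?case
      using integral_stopped_state_0[OF admissibleD(1)[OF admissible_viter]] by simp
  next
    case (Suc n)
    define k where "k = N - Suc n"
    have k: "N - n = Suc k" "n \<le> N"
      using Suc.prems by (auto simp: k_def)
    note [measurable] = admissibleD(1)[OF admissible_viter]
    \<comment> \<open>\<open>loss\<close> uses the same function at both times, whereas here the
      horizon shortens; inserting the maximiser rewrites it as a difference of successive iterates
      at time \<open>n\<close>. After killing both iterates equal the boundary indicator.\<close>
    have "AE \<omega> in P. loss (viter k) n \<omega> = viter k (stopped_state M n \<omega>) - viter (Suc k) (stopped_state M n \<omega>)"
      using act[of n] AE_live_pairs AE_space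
    proof eventually_elim
      case (elim \<omega>)
      note states = st_in_states[OF elim(3)]
      show ?case
      proof (cases "alive M n \<omega>")
        case True
        have "\<omega> t \<in> live_pairs M" if "t < n" for t
          using elim(2) True that by (auto simp: alive_def)
        then have "hist n \<omega> \<in> live_hists M n"
          using True measurable_space[OF measurable_hist, of \<omega> n] elim(3)
          by (auto simp: live_hists_def hist_def alive_def space_law)
        then show ?thesis
          using elim(1) True by (simp add: loss_def stopped_state_if_alive[OF states] k_def)
      next
        case False
        then show ?thesis
          using stopped_state_live_iff[OF states, of n] by (simp add: loss_def viter_not_live)
      qed
    qed
    then have "(\<integral>\<omega>. loss (viter k) n \<omega> \<partial>P) =
      (\<integral>\<omega>. viter k (stopped_state M n \<omega>) - viter (Suc k) (stopped_state M n \<omega>) \<partial>P)"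
      by (intro integral_cong_AE) measurable
    also have "\<dots> = (\<integral>\<omega>. viter k (stopped_state M n \<omega>) \<partial>P) - (\<integral>\<omega>. viter (Suc k) (stopped_state M n \<omega>) \<partial>P)"
      by (intro Bochner_Integration.integral_diff integrable_stopped_state admissibleD[OF admissible_viter])
    finally have "(\<integral>\<omega>. viter k (stopped_state M (Suc n) \<omega>) \<partial>P) = (\<integral>\<omega>. viter (Suc k) (stopped_state M n \<omega>) \<partial>P)"
      using integral_stopped_state_Suc[OF admissibleD[OF admissible_viter], of k n] by simp
    then show ?case
      using Suc.IH k by (simp add: k_def[symmetric])
  qed
  from this[of N] have "viter N x \<le> value_of M \<pi> x"
    using integral_reach_le_value_of[of N] by (simp add: viter_0)
  then show ?thesis
    using \<pi> by blast
qed

lemma Vstar_eq_vlim: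
  assumes x: "x \<in> states M"
  shows "Vstar M x = vlim x"
proof (rule antisym)
  \<comment> \<open>A supremum of reals is meaningful only for a nonempty bounded family: the
    backward policies give nonemptiness, \<open>vlim\<close> the bound.\<close>
  have "policies M \<noteq> {}"
    using viter_le_value[OF x] by auto
  then show "Vstar M x \<le> vlim x"
    unfolding Vstar_def using value_of_le_vlim[OF _ x] by (intro cSUP_least)
  have bdd: "bdd_above ((\<lambda>\<pi>. value_of M \<pi> x) ` policies M)"
    using value_of_le_vlim[OF _ x] by (intro bdd_aboveI2)
  have "viter n x \<le> Vstar M x" for n
    using viter_le_value[OF x, of n] cSUP_upper[OF _ bdd] unfolding Vstar_def by (auto intro: order_trans)
  then show "vlim x \<le> Vstar M x"
    unfolding vlim_def by (intro cSUP_least) auto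
qed

lemma admissible_Vstar: "admissible (Vstar M)"
proof -
  have "Vstar M \<in> borel_measurable (SX M) \<longleftrightarrow> vlim \<in> borel_measurable (SX M)"
    by (rule measurable_cong) (simp add: space_SX Vstar_eq_vlim)
  then show ?thesis
    using admissible_vlim by (auto simp: admissible_def Vstar_eq_vlim)
qed

lemma Vstar_not_live: "y \<in> states M \<Longrightarrow> y \<notin> live_states M \<Longrightarrow> Vstar M y = indicator (target M) y"
  by (simp add: Vstar_eq_vlim vlim_not_live)

lemma Vstar_excessive:
  assumes p: "(y, a) \<in> live_pairs M"
  shows "(\<integral>z. Vstar M z \<partial>trans_total M (y, a)) \<le> Vstar M y"
proof -
  have "(\<integral>z. Vstar M z \<partial>trans_total M (y, a)) = (\<integral>z. vlim z \<partial>trans_total M (y, a))"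
    using space_trans_total[OF live_pairs_space[OF p]]
    by (intro Bochner_Integration.integral_cong refl) (simp add: Vstar_eq_vlim)
  moreover have "y \<in> states M"
    using p live_states_subset by (auto simp: live_pairs_def)
  ultimately show ?thesis
    using vlim_excessive[OF p] by (simp add: Vstar_eq_vlim)
qed

end

section \<open>The three conditions\<close>

text \<open>The limit lies below every term and every term below the first, so equality of the two
  ends pins the whole sequence.\<close>

lemma decseq_lim_eq_start_iff:
  fixes z :: "nat \<Rightarrow> real"
  assumes dec: "decseq z" and lower: "\<And>n. c \<le> z n"
  shows "lim z = z 0 \<longleftrightarrow> (\<forall>n. z n = z 0)"
proof
  assume lim: "lim z = z 0"
  have "z \<longlonglongrightarrow> lim z"
    using decseq_convergent[OF dec, of c] lower by (metis limI)
  then have "lim z \<le> z n" for n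
    by (rule decseq_ge[OF dec])
  then show "\<forall>n. z n = z 0"
    using decseqD[OF dec, of 0] lim by (auto intro: antisym)
next
  assume "\<forall>n. z n = z 0"
  then have "z = (\<lambda>_. z 0)"
    by auto
  then have "z \<longlonglongrightarrow> z 0"
    by (metis tendsto_const)
  then show "lim z = z 0"
    by (rule limI)
qed

locale reach_feller_process = reach_feller M + reach_process M \<pi> x
  for M :: "('x::polish_space, 'a::polish_space) reach_mdp" and \<pi> :: "('x, 'a) policy" and x :: 'x
begin

text \<open>States before the stopped index are live, so only the last summand can be
  nonzero.\<close>

lemma W_Suc:
  assumes "\<omega> \<in> space P"
  shows "W M (Suc n) \<omega> = indicator (target M) (stopped_state M n \<omega>)"
proof -
  have "st t \<omega> \<notin> target M" if "t < stopped M n \<omega>" for t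
    using live_before_stopped[OF st_in_states[OF assms] that] by (simp add: live_states_def)
  then have "(\<Sum>t = 0..<stopped M n \<omega>. indicator (target M) (st t \<omega>)) = (0::real)"
    by (intro sum.neutral) simp
  then show ?thesis
    by (simp add: W_def stopped_state_def atLeastLessThanSuc_atLeastAtMost[symmetric])
qed

lemma zeta_Suc:
  assumes \<omega>: "\<omega> \<in> space P"
  shows "zeta M x (Suc n) \<omega> = Vstar M (stopped_state M (Suc n) \<omega>)"
proof -
  note states = st_in_states[OF \<omega>]
  have zeta: "zeta M x (Suc n) \<omega> = indicator (target M) (stopped_state M n \<omega>) +
    indicator (live_states M) (stopped_state M n \<omega>) *
      (indicator (region M) (stopped_state M (Suc n) \<omega>) * Vstar M (stopped_state M (Suc n) \<omega>))"
    by (simp add: zeta_def W_Suc[OF \<omega>] stopped_state_def[symmetric])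
  show ?thesis
  proof (cases "alive M n \<omega>")
    case True
    then have "stopped_state M n \<omega> \<in> live_states M"
      by (simp add: stopped_state_live_iff[OF states])
    moreover have "Vstar M y = 0" if "y \<in> states M" "y \<notin> region M" for y
      using Vstar_not_live[OF that(1)] that(2) target_subset by (auto simp: live_states_def split: split_indicator)
    ultimately show ?thesis
      using stopped_state_in_states[OF states] by (auto simp: zeta live_states_def split: split_indicator)
  next
    case False
    then have "stopped_state M n \<omega> \<notin> live_states M" "stopped_state M (Suc n) \<omega> = stopped_state M n \<omega>"
      by (simp_all add: stopped_state_live_iff[OF states] stopped_state_Suc[OF states])
    then show ?thesis
      using Vstar_not_live[OF stopped_state_in_states[OF states]] by (simp add: zeta)
  qed
qed

text \<open>At \<open>n = 0\<close> the variable is the constant \<open>Vstar M x\<close>, while the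
  initial state equals \<open>x\<close> only almost surely; at later indices the identity is
  pointwise.\<close>

lemma AE_zeta: "AE \<omega> in P. zeta M x n \<omega> = Vstar M (stopped_state M n \<omega>)"
proof (cases n)
  case 0
  then show ?thesis
    using AE_start by (auto simp: zeta_def elim!: eventually_mono)
next
  case (Suc m)
  then show ?thesis
    using zeta_Suc by (intro AE_I2) simp
qed

lemma Vstar_measurable[measurable]: "Vstar M \<in> borel_measurable (SX M)"
  and Vstar_bounds: "y \<in> states M \<Longrightarrow> 0 \<le> Vstar M y \<and> Vstar M y \<le> 1"
  using admissibleD[OF admissible_Vstar] by auto

section \<open>The history filtration\<close>

lemma measurable_hist_filtration:
  "hist n \<in> hist_filtration M n \<rightarrow>\<^sub>M hist_space M n"
  unfolding hist_filtration_def using measurable_space[OF measurable_hist]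
  by (intro measurable_vimage_algebra1) auto

lemma space_hist_filtration: "space (hist_filtration M n) = space (PiM UNIV (\<lambda>_. XA))"
  by (simp add: hist_filtration_def)

text \<open>The strict bound matters: \<open>hist n\<close> records full pairs only before time
  \<open>n\<close>, and at time \<open>n\<close> the state without the action.\<close>

lemma measurable_coord_filtration:
  assumes "s < n"
  shows "(\<lambda>\<omega>. \<omega> s) \<in> hist_filtration M n \<rightarrow>\<^sub>M XA"
proof -
  have "(\<lambda>h. fst h s) \<in> hist_space M n \<rightarrow>\<^sub>M XA"
    unfolding hist_space_def
    by (rule measurable_compose[OF measurable_fst measurable_component_singleton]) (use assms in simp)
  from measurable_compose[OF measurable_hist_filtration this] show ?thesis
    using assms by (simp add: hist_def)
qed

lemma measurable_st_filtration:
  assumes "s \<le> n"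
  shows "st s \<in> hist_filtration M n \<rightarrow>\<^sub>M SX M"
proof (cases "s = n")
  case True
  have "snd \<in> hist_space M n \<rightarrow>\<^sub>M SX M"
    by (simp add: hist_space_def)
  from measurable_compose[OF measurable_hist_filtration this] show ?thesis
    using True by (simp add: hist_def)
next
  case False
  then show ?thesis
    using measurable_compose[OF measurable_coord_filtration measurable_fst, of s n] assms
    by (simp add: st_def[abs_def])
qed

lemma sets_hist_filtration:
  assumes "m \<le> n"
  shows "sets (hist_filtration M m) \<subseteq> sets (hist_filtration M n)"
proof
  fix B assume "B \<in> sets (hist_filtration M m)"
  then obtain H where H: "H \<in> sets (hist_space M m)" "B = hist m -` H \<inter> space (PiM UNIV (\<lambda>_. XA))"
    using measurable_space[OF measurable_hist]
    by (auto simp: hist_filtration_def sets_vimage_algebra2 Pi_iff)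
  have "past m \<in> hist_filtration M n \<rightarrow>\<^sub>M PiM {0..<m} (\<lambda>_. XA)"
    using assms by (intro measurable_restrict measurable_coord_filtration) auto
  then have "hist m \<in> hist_filtration M n \<rightarrow>\<^sub>M hist_space M m"
    using measurable_st_filtration[OF assms] unfolding hist_def[abs_def] hist_space_def by measurable
  from measurable_sets[OF this H(1)] show "B \<in> sets (hist_filtration M n)"
    using H(2) by (simp add: space_hist_filtration)
qed

lemma subalgebra_hist_filtration: "subalgebra P (hist_filtration M n)"
  unfolding subalgebra_def
proof
  show "sets (hist_filtration M n) \<subseteq> sets P"
    using measurable_sets[OF measurable_hist] measurable_space[OF measurable_hist]
    by (auto simp: hist_filtration_def sets_vimage_algebra2 Pi_iff sets_law)
qed (simp add: space_hist_filtration space_law)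

text \<open>The filtration is not completed, so the almost sure identity \<open>AE_zeta\<close>
  would not give measurability. The pointwise \<open>zeta_Suc\<close> does, and index 0 is a
  constant.\<close>

lemma measurable_zeta_filtration: "zeta M x n \<in> borel_measurable (hist_filtration M n)"
proof (cases n)
  case 0
  then show ?thesis
    by (simp add: zeta_def[abs_def])
next
  case (Suc m)
  have "stopped_state M n \<in> hist_filtration M n \<rightarrow>\<^sub>M SX M"
    by (intro measurable_stopped_state measurable_st_filtration) (simp_all add: space_hist_filtration)
  from measurable_compose[OF this Vstar_measurable]
  have "(\<lambda>\<omega>. Vstar M (stopped_state M n \<omega>)) \<in> borel_measurable (hist_filtration M n)" .
  then show ?thesis
    by (rule measurable_cong[THEN iffD1, rotated])
      (simp add: Suc zeta_Suc space_hist_filtration space_law)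
qed

lemma measurable_zeta[measurable]: "zeta M x n \<in> borel_measurable P"
  by (rule measurable_from_subalg[OF subalgebra_hist_filtration measurable_zeta_filtration])

lemma integrable_zeta: "integrable P (zeta M x n)"
  using integrable_stopped_state[OF Vstar_measurable Vstar_bounds, of n] AE_zeta[of n]
  by (subst integrable_cong_AE) auto

section \<open>Means, losses and the three conditions\<close>

lemma integral_zeta: "(\<integral>\<omega>. zeta M x n \<omega> \<partial>P) = (\<integral>\<omega>. Vstar M (stopped_state M n \<omega>) \<partial>P)"
  using AE_zeta by (intro integral_cong_AE) measurable

lemma integral_zeta_0: "(\<integral>\<omega>. zeta M x 0 \<omega> \<partial>P) = Vstar M x"
  by (simp add: zeta_def prob_space)

lemma integral_zeta_Suc:
  "(\<integral>\<omega>. zeta M x (Suc n) \<omega> \<partial>P) = (\<integral>\<omega>. zeta M x n \<omega> \<partial>P) - (\<integral>\<omega>. loss (Vstar M) n \<omega> \<partial>P)"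
  unfolding integral_zeta by (rule integral_stopped_state_Suc[OF Vstar_measurable Vstar_bounds])

lemma AE_loss_nonneg: "AE \<omega> in P. 0 \<le> loss (Vstar M) n \<omega>"
  by (rule loss_nonneg[OF Vstar_excessive])

lemma loss_AE_zero_iff:
  "(AE \<omega> in P. loss (Vstar M) n \<omega> = 0) \<longleftrightarrow> (\<integral>\<omega>. loss (Vstar M) n \<omega> \<partial>P) = 0"
  by (rule integral_nonneg_eq_0_iff_AE[OF integrable_loss[OF Vstar_measurable Vstar_bounds] AE_loss_nonneg, symmetric])

text \<open>The means start at \<open>Vstar M x\<close> and drop by the mean loss at each step, and
  a nonnegative loss with mean zero vanishes almost surely.\<close>

lemma integral_zeta_const_iff:
  "(\<forall>n. (\<integral>\<omega>. zeta M x n \<omega> \<partial>P) = Vstar M x) \<longleftrightarrow> (\<forall>n. AE \<omega> in P. loss (Vstar M) n \<omega> = 0)"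
proof
  assume "\<forall>n. (\<integral>\<omega>. zeta M x n \<omega> \<partial>P) = Vstar M x"
  then show "\<forall>n. AE \<omega> in P. loss (Vstar M) n \<omega> = 0"
    unfolding loss_AE_zero_iff using integral_zeta_Suc by simp
next
  assume zero: "\<forall>n. AE \<omega> in P. loss (Vstar M) n \<omega> = 0"
  have "(\<integral>\<omega>. zeta M x n \<omega> \<partial>P) = Vstar M x" for n
    by (induction n) (use zero integral_zeta_0 in \<open>simp_all add: integral_zeta_Suc loss_AE_zero_iff\<close>)
  then show "\<forall>n. (\<integral>\<omega>. zeta M x n \<omega> \<partial>P) = Vstar M x"
    by blast
qed

lemma thrifty_iff: "thrifty_at M \<pi> x \<longleftrightarrow> (\<forall>n. AE \<omega> in P. loss (Vstar M) n \<omega> = 0)"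
proof -
  let ?z = "\<lambda>n. \<integral>\<omega>. zeta M x n \<omega> \<partial>P"
  have "decseq ?z"
    using integral_nonneg_AE[OF AE_loss_nonneg] by (intro decseq_SucI) (simp add: integral_zeta_Suc)
  moreover have "0 \<le> ?z n" for n
    unfolding integral_zeta using Vstar_bounds[OF stopped_state_in_states[OF st_in_states]]
    by (intro integral_nonneg_AE AE_I2) simp
  ultimately have "lim ?z = ?z 0 \<longleftrightarrow> (\<forall>n. ?z n = ?z 0)"
    by (rule decseq_lim_eq_start_iff)
  then show ?thesis
    unfolding integral_zeta_const_iff[symmetric] integral_zeta_0 thrifty_at_def Lambda_def by metis
qed

text \<open>Condition (iii) integrates over the region with \<open>trans\<close>, the loss over all
  states with \<open>trans_total\<close>. The kernels agree on the live pairs that are visited while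
  alive, and \<open>Vstar M\<close> vanishes outside the region. On killed paths both sides hold
  trivially.\<close>

lemma conserves_iff_loss:
  "AE \<omega> in P. (enat n < kill_time M \<omega> \<longrightarrow> conserves_Vstar_at M (ac n \<omega>) (st n \<omega>)) \<longleftrightarrow>
    loss (Vstar M) n \<omega> = 0"
  using AE_live_pairs AE_space
proof eventually_elim
  case (elim \<omega>)
  note states = st_in_states[OF elim(2)]
  show ?case
  proof (cases "alive M n \<omega>")
    case True
    then have live: "st n \<omega> \<in> live_states M"
      by (simp add: alive_def)
    have \<omega>n: "(st n \<omega>, ac n \<omega>) = \<omega> n"
      by (simp add: st_def ac_def)
    have p: "\<omega> n \<in> live_pairs M"
      using elim(1) True by blast
    have "(LINT y:region M|trans M (\<omega> n). Vstar M y) = (\<integral>y. Vstar M y \<partial>trans_total M (\<omega> n))"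
      unfolding trans_total_live[OF p, symmetric] set_lebesgue_integral_def
    proof (intro Bochner_Integration.integral_cong refl)
      fix y assume "y \<in> space (trans_total M (\<omega> n))"
      then have "y \<in> states M"
        using space_trans_total[OF coord_in_space[OF elim(2)]] by simp
      then show "indicator (region M) y *\<^sub>R Vstar M y = Vstar M y"
        using Vstar_not_live[of y] target_subset
        by (auto simp: live_states_def split: split_indicator)
    qed
    then show ?thesis
      using live True less_kill_time_iff[OF states, of n]
      by (auto simp: conserves_Vstar_at_def loss_def \<omega>n live_states_def)
  next
    case False
    then show ?thesis
      using less_kill_time_iff[OF states, of n] by (simp add: loss_def)
  qed
qed

lemma conserving_iff:
  "(AE \<omega> in P. enat n < kill_time M \<omega> \<longrightarrow> conserves_Vstar_at M (ac n \<omega>) (st n \<omega>)) \<longleftrightarrow>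
    (AE \<omega> in P. loss (Vstar M) n \<omega> = 0)"
  by (rule eventually_subst[OF conserves_iff_loss])

lemma finite_measure_subalgebra_hist: "finite_measure_subalgebra P (hist_filtration M n)"
  by unfold_locales (rule subalgebra_hist_filtration)

text \<open>Once the losses vanish, each increment of \<open>zeta\<close> integrates to zero over
  every event of the current history. The induction works because an event known at time
  \<open>m\<close> is also known at each later time \<open>k\<close>.\<close>

lemma integral_indicator_zeta:
  assumes B: "B \<in> sets (hist_filtration M m)" and mn: "m \<le> n"
    and zero: "\<And>n. AE \<omega> in P. loss (Vstar M) n \<omega> = 0"
  shows "(\<integral>\<omega>. indicator B \<omega> * zeta M x n \<omega> \<partial>P) = (\<integral>\<omega>. indicator B \<omega> * zeta M x m \<omega> \<partial>P)"
  using mn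
proof (induction rule: dec_induct)
  case (step k)
  have Bk: "B \<in> sets (hist_filtration M k)"
    using sets_hist_filtration[OF step(1)] B by blast
  have [measurable]: "B \<in> sets (PiM UNIV (\<lambda>_. XA))"
    using Bk subalgebra_hist_filtration[of k] by (auto simp: subalgebra_def sets_law)
  obtain H where H: "H \<in> sets (hist_space M k)" "B = hist k -` H \<inter> space (PiM UNIV (\<lambda>_. XA))"
    using Bk measurable_space[OF measurable_hist]
    by (auto simp: hist_filtration_def sets_vimage_algebra2 Pi_iff)
  \<comment> \<open>\<open>hist k\<close> is determined by the first \<open>Suc k\<close>
    coordinates, so \<open>B\<close> is the preimage of a set of truncated paths, the form in which
    the drift identity is stated.\<close>
  define C where "C = hist k -` H \<inter> space (PiM {0..<Suc k} (\<lambda>_. XA))"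
  have "hist k \<in> PiM {0..<Suc k} (\<lambda>_. XA) \<rightarrow>\<^sub>M hist_space M k"
    using measurable_past_le[of k "Suc k"] unfolding hist_def[abs_def] hist_space_def st_def by measurable
  from measurable_sets[OF this H(1)] have C: "C \<in> sets (PiM {0..<Suc k} (\<lambda>_. XA))"
    by (simp add: C_def)
  have hist_past: "hist k (past (Suc k) \<omega>) = hist k \<omega>" for \<omega>
    by (auto simp: hist_def st_def restrict_def)
  have ind: "indicator C (past (Suc k) \<omega>) = (indicator B \<omega> :: real)" if "\<omega> \<in> space P" for \<omega>
    using that past_in_space[OF that, of "Suc k"] H(2)
    by (simp add: C_def hist_past space_law split: split_indicator)
  have BC: "(\<integral>\<omega>. indicator B \<omega> * f \<omega> \<partial>P) = (\<integral>\<omega>. indicator C (past (Suc k) \<omega>) * f \<omega> \<partial>P)" for f :: "_ \<Rightarrow> real"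
    by (intro Bochner_Integration.integral_cong refl) (simp add: ind)
  have zeta: "(\<integral>\<omega>. indicator B \<omega> * zeta M x j \<omega> \<partial>P) =
      (\<integral>\<omega>. indicator B \<omega> * Vstar M (stopped_state M j \<omega>) \<partial>P)" for j
    using AE_zeta[of j] by (intro integral_cong_AE) auto
  have "(\<integral>\<omega>. indicator B \<omega> * loss (Vstar M) k \<omega> \<partial>P) = (\<integral>\<omega>. 0 \<partial>P)"
    using zero[of k] by (intro integral_cong_AE) auto
  then have "(\<integral>\<omega>. indicator B \<omega> * zeta M x (Suc k) \<omega> \<partial>P) = (\<integral>\<omega>. indicator B \<omega> * zeta M x k \<omega> \<partial>P)"
    unfolding zeta
    using integral_stopped_state_loss[OF C Vstar_measurable Vstar_bounds] by (simp add: BC)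
  then show ?case
    using step.IH by simp
qed simp

text \<open>A martingale has constant mean, which already forces all losses to vanish. Conversely,
  vanishing losses give the integrals that characterise the conditional expectation.\<close>

lemma martingale_iff:
  "martingale_wrt P (hist_filtration M) (zeta M x) \<longleftrightarrow> (\<forall>n. AE \<omega> in P. loss (Vstar M) n \<omega> = 0)"
proof
  assume mart: "martingale_wrt P (hist_filtration M) (zeta M x)"
  have "(\<integral>\<omega>. zeta M x n \<omega> \<partial>P) = Vstar M x" for n
  proof -
    interpret S: finite_measure_subalgebra P "hist_filtration M 0"
      by (rule finite_measure_subalgebra_hist)
    have "AE \<omega> in P. real_cond_exp P (hist_filtration M 0) (zeta M x n) \<omega> = zeta M x 0 \<omega>"
      using mart by (simp add: martingale_wrt_def)
    then have "(\<integral>\<omega>. real_cond_exp P (hist_filtration M 0) (zeta M x n) \<omega> \<partial>P) = (\<integral>\<omega>. zeta M x 0 \<omega> \<partial>P)"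
      by (intro integral_cong_AE) auto
    then show ?thesis
      using S.real_cond_exp_int(2)[OF integrable_zeta] by (simp add: integral_zeta_0)
  qed
  then show "\<forall>n. AE \<omega> in P. loss (Vstar M) n \<omega> = 0"
    unfolding integral_zeta_const_iff[symmetric] by blast
next
  assume zero: "\<forall>n. AE \<omega> in P. loss (Vstar M) n \<omega> = 0"
  show "martingale_wrt P (hist_filtration M) (zeta M x)"
    unfolding martingale_wrt_def
  proof (intro conjI allI impI)
    show "filtration (space P) (hist_filtration M)"
      by unfold_locales (simp_all add: space_hist_filtration space_law sets_hist_filtration)
    fix m n :: nat assume mn: "m \<le> n"
    interpret S: finite_measure_subalgebra P "hist_filtration M m"
      by (rule finite_measure_subalgebra_hist)
    show "AE \<omega> in P. real_cond_exp P (hist_filtration M m) (zeta M x n) \<omega> = zeta M x m \<omega>"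
      using integral_indicator_zeta[OF _ mn] zero
      by (intro S.real_cond_exp_charact integrable_zeta measurable_zeta_filtration)
        (simp add: set_lebesgue_integral_def)
  qed (rule subalgebra_hist_filtration measurable_zeta_filtration integrable_zeta)+
qed

end

theorem theorem2p18:
  fixes M :: "('x::polish_space, 'a::polish_space) reach_mdp"
    and \<pi> :: "('x, 'a) policy" and x :: 'x
  assumes "is_reach_mdp M"
    and "\<forall>y\<in>live_states M. compact (feas M y)"
    and "upper_hemicontinuous_on (live_states M) (actions M) (feas M)"
    and "weakly_measurable_on (live_states M) (actions M) (feas M)"
    and "strongly_Feller M"
    and "\<pi> \<in> policies M"
    and "x \<in> states M"
  shows "(thrifty_at M \<pi> x \<longleftrightarrow>
            martingale_wrt (mdp_law M \<pi> x) (hist_filtration M) (zeta M x)) \<and>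
         (martingale_wrt (mdp_law M \<pi> x) (hist_filtration M) (zeta M x) \<longleftrightarrow>
            (\<forall>n. AE \<omega> in mdp_law M \<pi> x.
               enat n < kill_time M \<omega> \<longrightarrow> conserves_Vstar_at M (ac n \<omega>) (st n \<omega>)))"
proof -
  interpret reach_feller_process M \<pi> x
    by unfold_locales (use assms in auto)
  show ?thesis
    by (simp add: thrifty_iff martingale_iff conserving_iff)
qed

end
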